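(* Let $k\geq 2$ and let $(\Sigma_k,\sigma)$ be the full one-sided shift on $k$ symbols. Then for each $i\in\{1,\dots,6\}$, the set $\{x\in Rec(\Sigma_k)\setminus BR(\Sigma_k): x \text{ satisfies Case } (i')\}$ is dense in $\Sigma_k$ and contains an uncountable DC1-scrambled subset.
   Context: $\Sigma_k=\{0,1,\dots,k-1\}^{\mathbb{N}}$ with metric $d(x,y)=\sum_{n\ge1}\delta(x_n,y_n)/2^n$ ($\delta(a,b)=0$ if $a=b$, $1$ otherwise) and shift $\sigma(x_1x_2\dots)=(x_2x_3\dots)$. $N(x,U)=\{n\ge1:\sigma^n(x)\in U\}$, $B_\varepsilon(x)$ the open $\varepsilon$-ball. For $S\subseteq\mathbb{N}$: $\overline d(S)=\limsup_n |S\cap\{0,\dots,n-1\}|/n$, $\underline d(S)=\liminf_n |S\cap\{0,\dots,n-1\}|/n$, $B^*(S)=\limsup_{|I|\to\infty}|S\cap I|/|I|$, $B_*(S)=\liminf_{|I|\to\infty}|S\cap I|/|I|$ ($I$ ranging over finite intervals of consecutive integers). $x\in Rec$ if $N(x,B_\varepsilon(x))\ne\emptyset$ for all $\varepsilon>0$; $x\in BR$ if $B^*(N(x,B_\varepsilon(x)))>0$ for all $\varepsilon>0$. For $\xi\in\{\overline d,\underline d,B^*,B_*\}$, $\omega_\xi(x)$ is the set of $y$ such that $\xi(N(x,B_\varepsilon(y)))>0$ for every $\varepsilon>0$; $\omega_\sigma(x)$ is the usual $\omega$-limit set. Cases: (1') $\omega_{B_*}(x)\subsetneq\omega_{\underline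 d}(x)=\omega_{\overline d}(x)=\omega_{B^*}(x)\subsetneq\omega_\sigma(x)$; (2') $\omega_{B_*}(x)\subsetneq\omega_{\underline d}(x)=\omega_{\overline d}(x)\subsetneq\omega_{B^*}(x)\subsetneq\omega_\sigma(x)$; (3') $\omega_{B_*}(x)=\omega_{\underline d}(x)\subsetneq\omega_{\overline d}(x)=\omega_{B^*}(x)\subsetneq\omega_\sigma(x)$; (4') $\omega_{B_*}(x)\subsetneq\omega_{\underline d}(x)\subsetneq\omega_{\overline d}(x)=\omega_{B^*}(x)\subsetneq\omega_\sigma(x)$; (5') $\omega_{B_*}(x)=\omega_{\underline d}(x)\subsetneq\omega_{\overline d}(x)\subsetneq\omega_{B^*}(x)\subsetneq\omega_\sigma(x)$; (6') $\omega_{B_*}(x)\subsetneq\omega_{\underline d}(x)\subsetneq\omega_{\overline d}(x)\subsetneq\omega_{B^*}(x)\subsetneq\omega_\sigma(x)$. DC1: with $\Phi^{(n)}_{xy}(t)=\frac1n|\{0\le i<n: d(\sigma^ix,\sigma^iy)<t\}|$, a pair $(x,y)$ is DC1 if $\liminf_n\Phi^{(n)}_{xy}(s)=0$ for some $s>0$ and $\limsup_n\Phi^{(n)}_{xy}(t)=1$ for all $t>0$; a set of at least two points is DC1-scrambled if every pair of distinct points in it is DC1. *)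

theory Defs
  imports "HOL-Analysis.Analysis"
begin

text \<open>Points of the full one-sided shift on k symbols are sequences indexed from 0
  (coordinate x_n of the paper is x (n-1)).\<close>

definition Sigma :: "nat \<Rightarrow> (nat \<Rightarrow> nat) set" where
  "Sigma k = {x. \<forall>n. x n < k}"

definition sdist :: "(nat \<Rightarrow> nat) \<Rightarrow> (nat \<Rightarrow> nat) \<Rightarrow> real" where
  "sdist x y = (\<Sum>n. (if x n = y n then 0 else 1) / 2 ^ (Suc n))"

definition shift :: "(nat \<Rightarrow> nat) \<Rightarrow> (nat \<Rightarrow> nat)" where
  "shift x = (\<lambda>n. x (Suc n))"

definition sball :: "nat \<Rightarrow> (nat \<Rightarrow> nat) \<Rightarrow> real \<Rightarrow> (nat \<Rightarrow> nat) set" where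
  "sball k y e = {z \<in> Sigma k. sdist y z < e}"

definition hits :: "(nat \<Rightarrow> nat) \<Rightarrow> (nat \<Rightarrow> nat) set \<Rightarrow> nat set" where
  "hits x U = {n. n \<ge> 1 \<and> (shift ^^ n) x \<in> U}"

definition upper_density :: "nat set \<Rightarrow> ereal" where
  "upper_density S = limsup (\<lambda>n. ereal (card (S \<inter> {0..<n}) / n))"

definition lower_density :: "nat set \<Rightarrow> ereal" where
  "lower_density S = liminf (\<lambda>n. ereal (card (S \<inter> {0..<n}) / n))"

definition upper_banach :: "nat set \<Rightarrow> ereal" where
  "upper_banach S = limsup (\<lambda>m. SUP i. ereal (card (S \<inter> {i..<i+m}) / m))"

definition lower_banach :: "nat set \<Rightarrow> ereal" where
  "lower_banach S = liminf (\<lambda>m. INF i. ereal (card (S \<inter> {i..<i+m}) / m))"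

definition Rec :: "nat \<Rightarrow> (nat \<Rightarrow> nat) set" where
  "Rec k = {x \<in> Sigma k. \<forall>e>0. hits x (sball k x e) \<noteq> {}}"

definition BR :: "nat \<Rightarrow> (nat \<Rightarrow> nat) set" where
  "BR k = {x \<in> Sigma k. \<forall>e>0. upper_banach (hits x (sball k x e)) > 0}"

definition omega_xi :: "(nat set \<Rightarrow> ereal) \<Rightarrow> nat \<Rightarrow> (nat \<Rightarrow> nat) \<Rightarrow> (nat \<Rightarrow> nat) set" where
  "omega_xi \<xi> k x = {y \<in> Sigma k. \<forall>e>0. \<xi> (hits x (sball k y e)) > 0}"

definition omega_shift :: "nat \<Rightarrow> (nat \<Rightarrow> nat) \<Rightarrow> (nat \<Rightarrow> nat) set" where
  "omega_shift k x = {y \<in> Sigma k. \<forall>e>0. infinite (hits x (sball k y e))}"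

definition case_prime :: "nat \<Rightarrow> nat \<Rightarrow> (nat \<Rightarrow> nat) \<Rightarrow> bool" where
  "case_prime i k x = (
     let Bl = omega_xi lower_banach k x; dl = omega_xi lower_density k x;
         du = omega_xi upper_density k x; Bu = omega_xi upper_banach k x;
         w = omega_shift k x in
     (i = 1 \<longrightarrow> Bl \<subset> dl \<and> dl = du \<and> du = Bu \<and> Bu \<subset> w) \<and>
     (i = 2 \<longrightarrow> Bl \<subset> dl \<and> dl = du \<and> du \<subset> Bu \<and> Bu \<subset> w) \<and>
     (i = 3 \<longrightarrow> Bl = dl \<and> dl \<subset> du \<and> du = Bu \<and> Bu \<subset> w) \<and>
     (i = 4 \<longrightarrow> Bl \<subset> dl \<and> dl \<subset> du \<and> du = Bu \<and> Bu \<subset> w) \<and>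
     (i = 5 \<longrightarrow> Bl = dl \<and> dl \<subset> du \<and> du \<subset> Bu \<and> Bu \<subset> w) \<and>
     (i = 6 \<longrightarrow> Bl \<subset> dl \<and> dl \<subset> du \<and> du \<subset> Bu \<and> Bu \<subset> w))"

definition Phi :: "(nat \<Rightarrow> nat) \<Rightarrow> (nat \<Rightarrow> nat) \<Rightarrow> nat \<Rightarrow> real \<Rightarrow> real" where
  "Phi x y n t = card {i. i < n \<and> sdist ((shift ^^ i) x) ((shift ^^ i) y) < t} / n"

definition DC1_pair :: "(nat \<Rightarrow> nat) \<Rightarrow> (nat \<Rightarrow> nat) \<Rightarrow> bool" where
  "DC1_pair x y \<longleftrightarrow>
     (\<exists>s>0. liminf (\<lambda>n. ereal (Phi x y n s)) = 0) \<and>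
     (\<forall>t>0. limsup (\<lambda>n. ereal (Phi x y n t)) = 1)"

definition DC1_scrambled :: "(nat \<Rightarrow> nat) set \<Rightarrow> bool" where
  "DC1_scrambled D \<longleftrightarrow> (\<exists>x\<in>D. \<exists>y\<in>D. x \<noteq> y) \<and>
     (\<forall>x\<in>D. \<forall>y\<in>D. x \<noteq> y \<longrightarrow> DC1_pair x y)"

definition dense_in_Sigma :: "nat \<Rightarrow> (nat \<Rightarrow> nat) set \<Rightarrow> bool" where
  "dense_in_Sigma k S \<longleftrightarrow> S \<subseteq> Sigma k \<and>
     (\<forall>x\<in>Sigma k. \<forall>e>0. \<exists>y\<in>S. sdist x y < e)"

end

theory Submission
  imports Defs
begin

text \<open>
  The points are built on zones \<open>[p j, p (j + 1))\<close> whose lengths grow superexponentially. A zone starts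
  with a copy of everything before it, which makes the point recurrent. A filler of length \<open>j\<close>
  follows: too short to be seen by natural densities, but long enough for the Banach density;
  it has period 2 in the cases where the Banach limit set is to exceed the upper density limit
  set, and is constant otherwise. The remaining main part fills almost the whole zone and is
  either constant or alternates between constant runs of length \<open>j + 1\<close>.

  Positions where the point deviates from the local rule of having symbols 0 and 1 and period 1 (or 2) have
  Banach density zero. Hence the Banach limit set contains only points of period at most 2, and it
  misses the recurrent point itself. Both symbols occur in arbitrarily long runs, so the lower Banach
  limit set is empty, while both constant points lie in the upper density limit set. A constant point
  is in the lower density limit set iff eventually every main part either alternates or has its
  symbol. Choosing the kind of each main part gives the six cases.

  The phase of the main parts is a free parameter. Two points with different parameters disagree on
  almost all of infinitely many zones and agree on almost all of infinitely many others, which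
  is DC1; the length of the initial word is arbitrary, which gives density.
\<close>

section \<open>Metric balls replaced by cylinders\<close>

section \<open>Cylinders\<close>

text \<open>Hitting times of the cylinder given by the first \<open>m\<close> symbols of
  \<open>y\<close>; \<open>n \<ge> 1\<close> matches \<open>hits\<close>.\<close>

definition occ :: "(nat \<Rightarrow> nat) \<Rightarrow> (nat \<Rightarrow> nat) \<Rightarrow> nat \<Rightarrow> nat set" where
  "occ x y m = {n. n \<ge> 1 \<and> (\<forall>i<m. x (n + i) = y i)}"

lemma shift_funpow: "(shift ^^ n) x i = x (n + i)"
  by (induction n arbitrary: i) (auto simp: shift_def)

lemma shift_funpow_Sigma: "x \<in> Sigma k \<Longrightarrow> (shift ^^ n) x \<in> Sigma k"
  by (auto simp: Sigma_def shift_funpow)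

lemma sums_half_power: "(\<lambda>n. 1 / 2 ^ Suc (n + m)) sums (1 / 2 ^ m :: real)"
proof -
  have "(\<lambda>n. (1/2::real) ^ n) sums (1 / (1 - 1/2))" by (rule geometric_sums) simp
  from sums_mult[OF this, of "1 / 2 ^ Suc m"] show ?thesis
    by (simp add: power_add power_one_over field_simps)
qed

lemma summable_sdist: "summable (\<lambda>n. (if x n = y n then 0 else 1) / 2 ^ Suc n :: real)"
  by (rule summable_comparison_test'[OF sums_summable[OF sums_half_power[of 0]], of 0]) auto

text \<open>A disagreement at \<open>i\<close> alone contributes \<open>1 / 2 ^ Suc i\<close>, which
  is at least \<open>1 / 2 ^ m\<close>.\<close>

lemma sdist_less_imp_eq:
  assumes "sdist x y < 1 / 2 ^ m" "i < m"
  shows "x i = y i"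
proof (rule ccontr)
  assume "x i \<noteq> y i"
  then have "1 / 2 ^ Suc i = (\<Sum>n\<in>{i}. (if x n = y n then 0 else 1) / 2 ^ Suc n :: real)" by simp
  also have "\<dots> \<le> sdist x y" unfolding sdist_def
    by (rule sum_le_suminf[OF summable_sdist]) auto
  finally have "1 / 2 ^ Suc i < (1 / 2 ^ m :: real)" using assms(1) by linarith
  moreover have "(2::real) ^ Suc i \<le> 2 ^ m" using assms(2) by (intro power_increasing) auto
  ultimately show False by (simp add: field_simps)
qed

lemma sdist_le_if_eq:
  assumes "\<And>i. i < m \<Longrightarrow> x i = y i"
  shows "sdist x y \<le> 1 / 2 ^ m"
proof -
  let ?f = "\<lambda>n. (if x n = y n then 0 else 1) / 2 ^ Suc n :: real"
  have "sdist x y = (\<Sum>n. ?f (n + m)) + sum ?f {..<m}" unfolding sdist_def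
    by (rule suminf_split_initial_segment[OF summable_sdist])
  also have "sum ?f {..<m} = 0" using assms by (intro sum.neutral) auto
  also have "(\<Sum>n. ?f (n + m)) \<le> (\<Sum>n. 1 / 2 ^ Suc (n + m))"
    using summable_ignore_initial_segment[OF summable_sdist] sums_summable[OF sums_half_power]
    by (rule suminf_le[rotated]) simp
  also have "\<dots> = 1 / 2 ^ m" by (rule sums_unique[OF sums_half_power, symmetric])
  finally show ?thesis by simp
qed

lemma ex_half_power_less: "e > 0 \<Longrightarrow> \<exists>m. 1 / 2 ^ m < (e::real)"
  using real_arch_pow_inv[of e "1/2"] by (auto simp: power_one_over)

lemma occ_subset_hits:
  assumes "x \<in> Sigma k" "1 / 2 ^ m < e"
  shows "occ x y m \<subseteq> hits x (sball k y e)"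
proof
  fix n assume n: "n \<in> occ x y m"
  then have "sdist y ((shift ^^ n) x) \<le> 1 / 2 ^ m"
    by (intro sdist_le_if_eq) (auto simp: occ_def shift_funpow)
  then show "n \<in> hits x (sball k y e)"
    using n assms shift_funpow_Sigma[OF assms(1)] by (auto simp: hits_def sball_def occ_def)
qed

lemma hits_subset_occ: "hits x (sball k y (1 / 2 ^ m)) \<subseteq> occ x y m"
  proof
  fix n assume n: "n \<in> hits x (sball k y (1 / 2 ^ m))"
  then have "y i = (shift ^^ n) x i" if "i < m" for i
    using that by (auto simp: hits_def sball_def intro: sdist_less_imp_eq)
  then show "n \<in> occ x y m" using n by (auto simp: occ_def hits_def shift_funpow)
qed

text \<open>Every ball around \<open>y\<close> contains a cylinder and conversely, so positivity on
  all sets of one family passes to the other by monotonicity.\<close>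

lemma omega_xi_iff:
  assumes "mono \<xi>" "x \<in> Sigma k"
  shows "y \<in> omega_xi \<xi> k x \<longleftrightarrow> y \<in> Sigma k \<and> (\<forall>m. \<xi> (occ x y m) > 0)"
proof -
  have "\<xi> (occ x y m) > 0" if "\<forall>e>0. \<xi> (hits x (sball k y e)) > 0" for m
  proof -
    have "0 < \<xi> (hits x (sball k y (1 / 2 ^ m)))" using that by simp
    also have "\<dots> \<le> \<xi> (occ x y m)" by (rule monoD[OF assms(1) hits_subset_occ])
    finally show ?thesis .
  qed
  moreover have "\<xi> (hits x (sball k y e)) > 0" if "\<forall>m. \<xi> (occ x y m) > 0" "e > 0" for e
  proof -
    obtain m where "1 / 2 ^ m < e" using ex_half_power_less \<open>e > 0\<close> by blast
    then have "\<xi> (occ x y m) \<le> \<xi> (hits x (sball k y e))"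
      by (intro monoD[OF assms(1)] occ_subset_hits[OF assms(2)])
    then show ?thesis using that(1) less_le_trans by blast
  qed
  ultimately show ?thesis by (auto simp: omega_xi_def)
qed

lemma in_omega_shift_if:
  assumes "x \<in> Sigma k" "y \<in> Sigma k" "\<And>m. infinite (occ x y m)"
  shows "y \<in> omega_shift k x"
  using assms ex_half_power_less
  by (auto simp: omega_shift_def) (meson occ_subset_hits finite_subset)

section \<open>Monotonicity of the four densities and criteria for their positivity\<close>

section \<open>Densities\<close>

lemma mono_upper_density: "mono upper_density"
  unfolding upper_density_def
  by (intro monoI Limsup_mono always_eventually allI)
     (auto intro!: divide_right_mono card_mono simp: Int_mono)

lemma mono_lower_density: "mono lower_density"
  unfolding lower_density_def
  by (intro monoI Liminf_mono always_eventually allI)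
     (auto intro!: divide_right_mono card_mono simp: Int_mono)

lemma mono_upper_banach: "mono upper_banach"
  unfolding upper_banach_def
  by (intro monoI Limsup_mono always_eventually allI SUP_mono')
     (auto intro!: divide_right_mono card_mono simp: Int_mono)

lemma mono_lower_banach: "mono lower_banach"
  unfolding lower_banach_def
  by (intro monoI Liminf_mono always_eventually allI INF_mono')
     (auto intro!: divide_right_mono card_mono simp: Int_mono)

lemma lower_le_upper_density: "lower_density S \<le> upper_density S"
  unfolding lower_density_def upper_density_def by (rule Liminf_le_Limsup) simp

lemma upper_density_le_banach: "upper_density S \<le> upper_banach S"
  unfolding upper_density_def upper_banach_def
  by (intro Limsup_mono always_eventually allI SUP_upper2[of 0]) auto

lemma le_Limsup_if_frequently:
  fixes f :: "_ \<Rightarrow> _ :: complete_linorder"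
  assumes "\<exists>\<^sub>F x in F. C \<le> f x"
  shows "C \<le> Limsup F f"
  using Limsup_lessD[of F f C] assms by (fastforce simp: frequently_def not_le)

lemma Liminf_le_if_frequently:
  fixes f :: "_ \<Rightarrow> _ :: complete_linorder"
  assumes "\<exists>\<^sub>F x in F. f x \<le> C"
  shows "Liminf F f \<le> C"
  using less_LiminfD[of C F f] assms by (fastforce simp: frequently_def not_le)

lemma ereal_not_pos_if_le:
  assumes "\<And>e. e > 0 \<Longrightarrow> z \<le> ereal e"
  shows "\<not> z > 0"
proof
  assume "z > 0"
  then obtain e where "0 < ereal e" "ereal e < z" using ereal_dense2 by blast
  then show False using assms[of e] by (auto simp: not_le[symmetric])
qed

lemma ereal_ratio_ge: "n > 0 \<Longrightarrow> c * real n \<le> real a \<Longrightarrow> ereal c \<le> ereal (a / n)"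
  by (simp add: field_simps)

text \<open>For \<open>n = 0\<close> the quotient is 0 by the convention on division;
  \<open>c \<ge> 0\<close> covers that case.\<close>

lemma ereal_ratio_le: "real a \<le> c * real n \<Longrightarrow> c \<ge> 0 \<Longrightarrow> ereal (a / n) \<le> ereal c"
  by (cases "n = 0") (auto simp: field_simps)

text \<open>This and the following criteria turn limits into counting estimates that hold eventually
  or frequently.\<close>

lemma upper_density_pos:
  assumes "c > 0" "\<exists>\<^sub>F n in sequentially. c * real n \<le> card (S \<inter> {0..<n})"
  shows "upper_density S > 0"
proof -
  have "\<exists>\<^sub>F n in sequentially. ereal c \<le> ereal (card (S \<inter> {0..<n}) / n)"
    by (rule frequently_rev_mp[OF assms(2)])
       (rule eventually_mono[OF eventually_gt_at_top[of 0]], use ereal_ratio_ge in blast)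
  then have "ereal c \<le> upper_density S" unfolding upper_density_def by (rule le_Limsup_if_frequently)
  moreover have "0 < ereal c" using assms(1) by simp
  ultimately show ?thesis by (rule less_le_trans[rotated])
qed

lemma upper_density_not_pos:
  assumes "\<And>e::real. e > 0 \<Longrightarrow> \<forall>\<^sub>F n in sequentially. card (S \<inter> {0..<n}) \<le> e * real n"
  shows "\<not> upper_density S > 0"
proof -
  have "upper_density S \<le> ereal e" if "e > 0" for e
    unfolding upper_density_def
    by (rule Limsup_bounded, rule eventually_mono[OF assms[OF that]], rule ereal_ratio_le) (use that in auto)
  then show ?thesis by (rule ereal_not_pos_if_le)
qed

lemma lower_density_pos:
  assumes "c > 0" "\<forall>\<^sub>F n in sequentially. c * real n \<le> card (S \<inter> {0..<n})"
  shows "lower_density S > 0"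
proof -
  have "ereal c \<le> lower_density S" unfolding lower_density_def
    by (rule Liminf_bounded, rule eventually_mono[OF eventually_conj[OF assms(2) eventually_gt_at_top[of 0]]])
       (use ereal_ratio_ge in blast)
  moreover have "0 < ereal c" using assms(1) by simp
  ultimately show ?thesis by (rule less_le_trans[rotated])
qed

lemma lower_density_not_pos:
  assumes "\<And>e::real. e > 0 \<Longrightarrow> \<exists>\<^sub>F n in sequentially. card (S \<inter> {0..<n}) \<le> e * real n"
  shows "\<not> lower_density S > 0"
proof -
  have "lower_density S \<le> ereal e" if "e > 0" for e
    unfolding lower_density_def
    by (rule Liminf_le_if_frequently, rule frequently_elim1[OF assms[OF that]], rule ereal_ratio_le)
       (use that in auto)
  then show ?thesis by (rule ereal_not_pos_if_le)
qed

lemma upper_banach_pos: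
  assumes "c > 0" "\<exists>\<^sub>F m in sequentially. \<exists>a. c * real m \<le> card (S \<inter> {a..<a+m})"
  shows "upper_banach S > 0"
proof -
  have "\<exists>\<^sub>F m in sequentially. ereal c \<le> (SUP a. ereal (card (S \<inter> {a..<a+m}) / m))"
    by (rule frequently_rev_mp[OF assms(2)])
       (rule eventually_mono[OF eventually_gt_at_top[of 0]], use ereal_ratio_ge in \<open>blast intro: SUP_upper2\<close>)
  then have "ereal c \<le> upper_banach S" unfolding upper_banach_def by (rule le_Limsup_if_frequently)
  moreover have "0 < ereal c" using assms(1) by simp
  ultimately show ?thesis by (rule less_le_trans[rotated])
qed

lemma upper_banach_not_pos:
  assumes "\<And>e::real. e > 0 \<Longrightarrow> \<forall>\<^sub>F m in sequentially. \<forall>a. card (S \<inter> {a..<a+m}) \<le> e * real m"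
  shows "\<not> upper_banach S > 0"
proof -
  have "upper_banach S \<le> ereal e" if "e > 0" for e
    unfolding upper_banach_def
    by (rule Limsup_bounded, rule eventually_mono[OF assms[OF that]], rule SUP_least, rule ereal_ratio_le)
       (use that in auto)
  then show ?thesis by (rule ereal_not_pos_if_le)
qed

lemma lower_banach_not_pos:
  assumes "\<And>m. \<exists>a. S \<inter> {a..<a+m} = {}"
  shows "\<not> lower_banach S > 0"
proof -
  have "(INF a. ereal (card (S \<inter> {a..<a+m}) / m)) \<le> 0" for m
  proof -
    obtain a where "S \<inter> {a..<a+m} = {}" using assms by blast
    then show ?thesis by (intro INF_lower2[of a]) (auto simp: zero_ereal_def)
  qed
  then have "lower_banach S \<le> Liminf sequentially (\<lambda>_. 0)"
    unfolding lower_banach_def by (intro Liminf_mono always_eventually) auto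
  then show ?thesis by (simp add: Liminf_const not_less)
qed

text \<open>A finite set contributes at most \<open>card S\<close> to any window, which is
  negligible against long windows.\<close>

lemma upper_banach_pos_imp_infinite:
  assumes "upper_banach S > 0"
  shows "infinite S"
proof
  assume fin: "finite S"
  have "\<forall>\<^sub>F m in sequentially. \<forall>a. card (S \<inter> {a..<a+m}) \<le> e * real m" if "e > 0" for e
  proof -
    have "\<forall>\<^sub>F m in sequentially. card S / e \<le> real m"
      using filterlim_at_top filterlim_real_sequentially by blast
    then show ?thesis
    proof (rule eventually_mono, intro allI)
      fix m a assume "card S / e \<le> real m"
      then have "real (card S) \<le> e * real m" using that by (simp add: field_simps)
      moreover have "card (S \<inter> {a..<a+m}) \<le> card S" using fin by (intro card_mono) auto
      ultimately show "card (S \<inter> {a..<a+m}) \<le> e * real m" by linarith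
    qed
  qed
  then show False using upper_banach_not_pos assms by blast
qed

section \<open>Residue classes in finite windows\<close>

section \<open>Counting in windows\<close>

text \<open>Reduction mod \<open>L\<close> is a bijection from any \<open>L\<close> consecutive
  integers onto the residues, wherever the window starts.\<close>

lemma card_residue_window:
  fixes a L :: nat
  assumes "R \<subseteq> {..<L}"
  shows "card {n \<in> {a..<a+L}. n mod L \<in> R} = card R"
proof (rule bij_betw_same_card[where f = "\<lambda>n. n mod L"])
  let ?W = "{n \<in> {a..<a+L}. n mod L \<in> R}"
  have "inj_on (\<lambda>n. n mod L) ?W"
  proof (rule inj_onI)
    fix n n' assume n: "n \<in> ?W" "n' \<in> ?W" and "n mod L = n' mod L"
    then have "L dvd n - n'" "L dvd n' - n" by (metis mod_eq_dvd_iff_nat nat_le_linear diff_is_0_eq dvd_0_right)+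
    moreover have "n - n' < L" "n' - n < L" using n by auto
    ultimately have "n - n' = 0" "n' - n = 0" by (auto dest: dvd_imp_le)
    then show "n = n'" by simp
  qed
  moreover have "r \<in> (\<lambda>n. n mod L) ` ?W" if "r \<in> R" for r
  proof -
    have "r < L" using that assms by auto
    \<comment> \<open>The first number from \<open>a\<close> on in the class of \<open>r\<close>;
      adding \<open>L - a mod L\<close> in place of subtracting \<open>a mod L\<close> avoids
      truncation.\<close>
    define n where "n = a + (r + (L - a mod L)) mod L"
    have "n mod L = (a mod L + (r + (L - a mod L)) mod L) mod L" unfolding n_def by (simp only: mod_add_left_eq)
    also have "\<dots> = (a mod L + (r + (L - a mod L))) mod L" by (simp only: mod_add_right_eq)
    also have "a mod L + (r + (L - a mod L)) = r + L"
      using \<open>r < L\<close> mod_less_divisor[of L a] by linarith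
    finally have "n mod L = r" using \<open>r < L\<close> by simp
    moreover have "n \<in> {a..<a+L}" using \<open>r < L\<close> by (simp add: n_def)
    ultimately show ?thesis using that by (intro image_eqI[of _ _ n]) auto
  qed
  ultimately show "bij_betw (\<lambda>n. n mod L) ?W R" by (auto simp: bij_betw_def)
qed

lemma card_residue_windows:
  fixes a L :: nat
  assumes "R \<subseteq> {..<L}"
  shows "card {n \<in> {a..<a+q*L}. n mod L \<in> R} = q * card R"
proof (induction q)
  case (Suc q)
  define c where "c = a + q * L"
  have split: "{n \<in> {a..<c+L}. n mod L \<in> R} = {n \<in> {a..<c}. n mod L \<in> R} \<union> {n \<in> {c..<c+L}. n mod L \<in> R}"
    using le_add1[of a "q * L"] unfolding c_def[symmetric] by auto
  have "a + Suc q * L = c + L" by (simp add: c_def)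
  then have "card {n \<in> {a..<a+Suc q*L}. n mod L \<in> R} = card ({n \<in> {a..<c}. n mod L \<in> R} \<union> {n \<in> {c..<c+L}. n mod L \<in> R})"
    by (simp only: split)
  also have "\<dots> = card {n \<in> {a..<c}. n mod L \<in> R} + card {n \<in> {c..<c+L}. n mod L \<in> R}"
    by (rule card_Un_disjoint) auto
  also have "\<dots> = q * card R + card R"
    unfolding card_residue_window[OF assms] using Suc by (simp only: c_def)
  finally show ?case by simp
qed auto

text \<open>The window is rounded down to whole periods here, and up in the next lemma.\<close>

lemma card_residue_ge:
  fixes a L M :: nat
  assumes "R \<subseteq> {..<L}"
  shows "(M div L) * card R \<le> card {n \<in> {a..<a+M}. n mod L \<in> R}"
proof -
  have "a + (M div L) * L \<le> a + M" by simp
  then have "{n \<in> {a..<a+(M div L)*L}. n mod L \<in> R} \<subseteq> {n \<in> {a..<a+M}. n mod L \<in> R}" by (auto intro: less_le_trans)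
  from card_mono[OF _ this] show ?thesis by (simp only: card_residue_windows[OF assms]) simp
qed

lemma card_residue_le:
  fixes a L M :: nat
  assumes "R \<subseteq> {..<L}" "L > 0"
  shows "card {n \<in> {a..<a+M}. n mod L \<in> R} \<le> (M div L + 1) * card R"
proof -
  have "M < (M div L + 1) * L" using assms(2) dividend_less_div_times[of L M] by (simp add: algebra_simps)
  then have "{n \<in> {a..<a+M}. n mod L \<in> R} \<subseteq> {n \<in> {a..<a+(M div L + 1)*L}. n mod L \<in> R}" by auto
  from card_mono[OF _ this] show ?thesis by (simp only: card_residue_windows[OF assms(1)]) simp
qed

lemma card_window_split:
  fixes a :: nat
  assumes "a \<le> c"
  shows "card (S \<inter> {a..<d}) \<le> card (S \<inter> {a..<c}) + card (S \<inter> {c..<d})"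
proof -
  have "S \<inter> {a..<d} \<subseteq> (S \<inter> {a..<c}) \<union> (S \<inter> {c..<d})" by auto
  from card_mono[OF _ this] show ?thesis using card_Un_le[of "S \<inter> {a..<c}" "S \<inter> {c..<d}"] by auto
qed

lemma Suc_times_div_le: "Suc j * (n div Suc j) \<le> n"
  by (metis mult.commute div_times_less_eq_dividend)

section \<open>Points assembled from zones\<close>

section \<open>Points made of zones\<close>

text \<open>Kept outside the locale because \<open>zone_start\<close> satisfies the same recursion
  before any point is built on it.\<close>

lemma zone_bounds:
  fixes p :: "nat \<Rightarrow> nat"
  assumes "p 0 \<ge> 1" "\<And>j. p (Suc j) = (j + 10) * p j"
  shows "j + 1 \<le> p j" "i \<le> j \<Longrightarrow> p i \<le> p j"
proof -
  show "j + 1 \<le> p j"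
  proof (induction j)
    case (Suc j)
    then have "(j + 10) * (j + 1) \<le> p (Suc j)" unfolding assms(2) by (intro mult_le_mono) auto
    then show ?case by (simp add: algebra_simps)
  qed (use assms(1) in auto)
  show "p i \<le> p j" if "i \<le> j"
    using that by (rule lift_Suc_mono_le[of p, rotated]) (simp add: assms(2))
qed

text \<open>Zone \<open>j\<close> starts at \<open>p j\<close>; \<open>b j\<close> is the symbol of
  its main part, or the phase if the part alternates, and \<open>P\<close> is the filler period.
  Below \<open>p 0\<close> the word is arbitrary and may use symbols above 1.\<close>

locale zoned =
  fixes x p b :: "nat \<Rightarrow> nat" and alt :: "nat \<Rightarrow> bool" and P :: nat
  assumes p_0: "p 0 \<ge> 1"
    and p_Suc: "p (Suc j) = (j + 10) * p j"
    and P: "P = 1 \<or> P = 2"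
    and b_less: "b j < 2"
    and copy: "p j \<le> n \<Longrightarrow> n < 2 * p j \<Longrightarrow> x n = x (n - p j)"
    and filler: "2 * p j \<le> n \<Longrightarrow> n < 2 * p j + j \<Longrightarrow> x n = n mod P"
    and main: "2 * p j + j \<le> n \<Longrightarrow> n < p (Suc j) \<Longrightarrow>
      x n = (if alt j then (b j + n div Suc j) mod 2 else b j)"
begin

text \<open>\<open>bad 1\<close> controls natural densities, \<open>bad P\<close> the Banach
  density: fillers may be bad for period 1 but not for \<open>P\<close>, except near their
  ends.\<close>

definition bad :: "nat \<Rightarrow> nat set" where
  "bad Q = {n. \<not> (x n < 2 \<and> x n = x (n + Q))}"

subsection \<open>Zones\<close>

lemmas p_ge = zone_bounds(1)[of p, OF p_0 p_Suc]
  and p_mono = zone_bounds(2)[of p, OF p_0 p_Suc]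

lemma p_Suc_ge: "10 * p j \<le> p (Suc j)"
  by (simp add: p_Suc)

lemma zone_exists:
  assumes "p i \<le> n"
  obtains j where "i \<le> j" "p j \<le> n" "n < p (Suc j)"
proof -
  have "\<exists>j. n < p j" using p_ge[of n] by (intro exI[of _ n]) auto
  then obtain l where l: "n < p l" "\<And>j. j < l \<Longrightarrow> \<not> n < p j" using exists_least_iff[of "\<lambda>j. n < p j"] by auto
  then have "i < l" using assms p_mono[of l i] by (cases "i < l") auto
  then obtain j where "l = Suc j" by (cases l) auto
  then show ?thesis using that[of j] l \<open>i < l\<close> by (auto simp: not_less)
qed

section \<open>Bad positions have density zero, and Banach density zero for period P\<close>

subsection \<open>Bad positions are rare\<close>

text \<open>Runs are aligned to multiples of \<open>Suc j\<close>, so a position of a main part can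
  be bad only if moving on by \<open>Q\<close> enters another block.\<close>

lemma bad_main:
  assumes "2 * p j + j \<le> n" "n + Q < p (Suc j)" "n \<in> bad Q"
  shows "Suc j \<le> n mod Suc j + Q"
proof (rule ccontr)
  assume "\<not> ?thesis"
  moreover have "Suc j * (n div Suc j) + n mod Suc j = n" by (rule mult_div_mod_eq)
  ultimately have "Suc j * (n div Suc j) \<le> n + Q" "n + Q < Suc j * Suc (n div Suc j)"
    unfolding mult_Suc_right by linarith+
  then have "(n + Q) div Suc j = n div Suc j" by (rule div_nat_eqI)
  then show False using assms main[of j n] main[of j "n + Q"] b_less[of j] by (auto simp: bad_def split: if_splits)
qed

lemma bad_filler:
  assumes "2 * p j \<le> n" "n + P < 2 * p j + j"
  shows "n \<notin> bad P"
proof -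
  have "x n < 2" using filler[of j n] assms P by auto
  then show ?thesis using filler[of j n] filler[of j "n + P"] assms by (simp add: bad_def)
qed

lemma bad_copy:
  assumes "p j \<le> n" "n + Q < 2 * p j"
  shows "n \<in> bad Q \<longleftrightarrow> n - p j \<in> bad Q"
  using copy[of j n] copy[of j "n + Q"] assms by (auto simp: bad_def)

lemma card_bad_main:
  assumes "2 * p j + j \<le> a" "a + M \<le> p (Suc j)" "Q \<in> {1, 2}"
  shows "card (bad Q \<inter> {a..<a+M}) \<le> Q + (M div Suc j + 1) * Q"
proof -
  let ?R = "{Suc j - Q..<Suc j}"
  \<comment> \<open>Besides the last \<open>Q\<close> residues of each block, the last
    \<open>Q\<close> positions of the zone are counted: there \<open>n + Q\<close> leaves the
    zone.\<close>
  have "bad Q \<inter> {a..<a+M} \<subseteq> {n \<in> {a..<a+M}. n mod Suc j \<in> ?R} \<union> {p (Suc j) - Q..<p (Suc j)}"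
    using bad_main[of j _ Q] assms by (auto simp: le_diff_conv)
  then have "card (bad Q \<inter> {a..<a+M}) \<le> card ({n \<in> {a..<a+M}. n mod Suc j \<in> ?R} \<union> {p (Suc j) - Q..<p (Suc j)})"
    by (rule card_mono[rotated]) auto
  also have "\<dots> \<le> card {n \<in> {a..<a+M}. n mod Suc j \<in> ?R} + card {p (Suc j) - Q..<p (Suc j)}"
    by (rule card_Un_le)
  also have "\<dots> \<le> (M div Suc j + 1) * Q + Q"
  proof (rule add_mono)
    have "card {n \<in> {a..<a+M}. n mod Suc j \<in> ?R} \<le> (M div Suc j + 1) * card ?R"
      by (rule card_residue_le) auto
    also have "\<dots> \<le> (M div Suc j + 1) * Q" by (rule mult_le_mono2) auto
    finally show "card {n \<in> {a..<a+M}. n mod Suc j \<in> ?R} \<le> (M div Suc j + 1) * Q" .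
  qed auto
  finally show ?thesis by simp
qed

lemma card_bad_prefix_zone:
  assumes "p j \<le> n" "n \<le> p (Suc j)"
  shows "card (bad 1 \<inter> {0..<n}) \<le> 2 * card (bad 1 \<inter> {0..<p j}) + n div Suc j + j + 3"
proof -
  let ?B = "bad 1 \<inter> {0..<p j}" and ?I = "{2*p j+j..<2*p j+j+(n-(2*p j+j))}"
  \<comment> \<open>The pieces are the earlier zones, their copy, the seam where
    \<open>m + 1\<close> leaves the copy, the whole filler, and the main part. Truncated subtraction
    makes \<open>?I\<close> empty if \<open>n\<close> does not reach the main part.\<close>
  have "bad 1 \<inter> {0..<n} \<subseteq> ?B \<union> (\<lambda>m. m + p j) ` ?B \<union> {2*p j-1} \<union> {2*p j..<2*p j+j} \<union> (bad 1 \<inter> ?I)"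
  proof
    fix m assume m: "m \<in> bad 1 \<inter> {0..<n}"
    show "m \<in> ?B \<union> (\<lambda>m. m + p j) ` ?B \<union> {2*p j-1} \<union> {2*p j..<2*p j+j} \<union> (bad 1 \<inter> ?I)"
    proof (cases "p j \<le> m \<and> m + 1 < 2 * p j")
      case True
      then have "m - p j \<in> ?B" using bad_copy[of j m 1] m by auto
      then show ?thesis using True by (force intro: rev_image_eqI)
    qed (use m in auto)
  qed
  then have "card (bad 1 \<inter> {0..<n}) \<le> card (?B \<union> (\<lambda>m. m + p j) ` ?B \<union> {2*p j-1} \<union> {2*p j..<2*p j+j} \<union> (bad 1 \<inter> ?I))"
    by (rule card_mono[rotated]) auto
  also have "\<dots> \<le> card ?B + card ((\<lambda>m. m + p j) ` ?B) + card {2*p j-1} + card {2*p j..<2*p j+j} + card (bad 1 \<inter> ?I)"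
    by (intro card_Un_le[THEN order_trans] add_right_mono order_refl)
  also have "card ((\<lambda>m. m + p j) ` ?B) \<le> card ?B" by (rule card_image_le) simp
  also have "card (bad 1 \<inter> ?I) \<le> n div Suc j + 2"
  proof (cases "n \<le> 2*p j+j")
    case False
    then have "card (bad 1 \<inter> ?I) \<le> 1 + ((n-(2*p j+j)) div Suc j + 1) * 1"
      using assms by (intro card_bad_main) auto
    also have "\<dots> \<le> n div Suc j + 2" by (simp add: div_le_mono)
    finally show ?thesis .
  qed simp
  finally show ?thesis by simp
qed

text \<open>The trivial bound \<open>p j\<close> for the earlier bad positions replaces an
  induction, since \<open>Suc j * p j \<le> p (Suc j)\<close>.\<close>

lemma card_bad_prefix_p: "Suc j * card (bad 1 \<inter> {0..<p (Suc j)}) \<le> 4 * p (Suc j)"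
proof -
  have "card (bad 1 \<inter> {0..<p j}) \<le> card {0..<p j}" by (rule card_mono) auto
  then have "card (bad 1 \<inter> {0..<p (Suc j)}) \<le> 2 * p j + p (Suc j) div Suc j + j + 3"
    using card_bad_prefix_zone[of j "p (Suc j)"] p_Suc_ge[of j] by simp
  then have "Suc j * card (bad 1 \<inter> {0..<p (Suc j)}) \<le> Suc j * (2 * p j + p (Suc j) div Suc j + j + 3)"
    by (rule mult_le_mono2)
  also have "\<dots> = 2 * (Suc j * p j) + Suc j * (p (Suc j) div Suc j) + Suc j * (j + 3)"
    by (simp add: algebra_simps)
  also have "\<dots> \<le> 2 * p (Suc j) + p (Suc j) + p (Suc j)"
  proof (intro add_mono mult_le_mono2)
    show "Suc j * p j \<le> p (Suc j)" unfolding p_Suc by (rule mult_le_mono1) simp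
    show "Suc j * (p (Suc j) div Suc j) \<le> p (Suc j)" by (rule Suc_times_div_le)
    have "(j + 3) * Suc j \<le> (j + 10) * p j" using p_ge[of j] by (intro mult_le_mono) auto
    then show "Suc j * (j + 3) \<le> p (Suc j)" unfolding p_Suc by (simp only: mult.commute)
  qed
  finally show ?thesis by simp
qed

text \<open>Inside zone \<open>i = Suc l\<close>, the prefix up to \<open>p i\<close> is controlled
  by the estimate at the end of zone \<open>l\<close>; hence the factor \<open>Suc l\<close>, which
  is at least \<open>Suc j\<close>.\<close>

lemma card_bad1_prefix:
  assumes "p (Suc j) \<le> n"
  shows "Suc j * card (bad 1 \<inter> {0..<n}) \<le> 12 * n"
proof -
  obtain i where i: "Suc j \<le> i" "p i \<le> n" "n < p (Suc i)" using zone_exists[OF assms] .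
  then obtain l where l: "i = Suc l" "j \<le> l" by (cases i) auto
  have "Suc j * card (bad 1 \<inter> {0..<n}) \<le> Suc l * card (bad 1 \<inter> {0..<n})" using l by (intro mult_le_mono1) auto
  also have "\<dots> \<le> Suc l * (2 * card (bad 1 \<inter> {0..<p i}) + n div Suc i + i + 3)"
    using card_bad_prefix_zone[of i n] i by (intro mult_le_mono2) auto
  also have "\<dots> = 2 * (Suc l * card (bad 1 \<inter> {0..<p i})) + Suc l * (n div Suc i) + Suc l * (l + 4)"
    by (simp add: l(1) algebra_simps)
  also have "\<dots> \<le> 2 * (4 * p i) + n + p i"
  proof (intro add_mono mult_le_mono2)
    show "Suc l * card (bad 1 \<inter> {0..<p i}) \<le> 4 * p i" unfolding l by (rule card_bad_prefix_p)
    have "Suc l * (n div Suc i) \<le> Suc i * (n div Suc i)" unfolding l by (intro mult_le_mono1) auto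
    also have "\<dots> \<le> n" by (rule Suc_times_div_le)
    finally show "Suc l * (n div Suc i) \<le> n" .
    have "(l + 4) * Suc l \<le> (l + 10) * p l" using p_ge[of l] by (intro mult_le_mono) auto
    then show "Suc l * (l + 4) \<le> p i" unfolding l p_Suc by (simp only: mult.commute)
  qed
  finally show ?thesis using i by simp
qed

text \<open>For \<open>P = 2\<close>, two consecutive good steps of period 1 compose to a good step
  of period 2.\<close>

lemma bad_P_subset: "bad P \<subseteq> bad 1 \<union> (\<lambda>n. n - 1) ` (bad 1 \<inter> {1..})"
proof
  fix n assume n: "n \<in> bad P"
  have "n \<in> (\<lambda>n. n - 1) ` (bad 1 \<inter> {1..})" if "n + 1 \<in> bad 1"
    using that by (intro image_eqI[of _ _ "n + 1"]) auto
  then show "n \<in> bad 1 \<union> (\<lambda>n. n - 1) ` (bad 1 \<inter> {1..})"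
    using n P by (cases "n \<in> bad 1"; cases "n + 1 \<in> bad 1") (auto simp: bad_def numeral_2_eq_2)
qed

lemma card_bad_prefix:
  assumes "p (Suc j) \<le> n"
  shows "Suc j * card (bad P \<inter> {0..<n}) \<le> 25 * n"
proof -
  let ?B = "bad 1 \<inter> {0..<n}"
  \<comment> \<open>Shifting back by one admits one position beyond the prefix, hence the extra
    \<open>n\<close>.\<close>
  have "bad P \<inter> {0..<n} \<subseteq> ?B \<union> (\<lambda>n. n - 1) ` (?B \<union> {n})"
    using bad_P_subset by (fastforce simp: image_iff)
  then have "card (bad P \<inter> {0..<n}) \<le> card (?B \<union> (\<lambda>n. n - 1) ` (?B \<union> {n}))"
    by (rule card_mono[rotated]) auto
  also have "\<dots> \<le> card ?B + card ((\<lambda>n. n - 1) ` (?B \<union> {n}))" by (rule card_Un_le)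
  also have "card ((\<lambda>n. n - 1) ` (?B \<union> {n})) \<le> card (?B \<union> {n})" by (rule card_image_le) simp
  also have "card (?B \<union> {n}) \<le> card ?B + card {n}" by (rule card_Un_le)
  finally have "card (bad P \<inter> {0..<n}) \<le> 2 * card ?B + 1" by simp
  then have "Suc j * card (bad P \<inter> {0..<n}) \<le> Suc j * (2 * card ?B + 1)" by (rule mult_le_mono2)
  then have "Suc j * card (bad P \<inter> {0..<n}) \<le> 2 * (Suc j * card ?B) + Suc j" by (simp add: algebra_simps)
  moreover have "Suc j \<le> n" using assms p_ge[of "Suc j"] by simp
  ultimately show ?thesis using card_bad1_prefix[OF assms] by linarith
qed

text \<open>Past the copy, the filler is bad at most in its last \<open>P\<close> positions, and the
  main part at most \<open>P\<close> times per block, up to boundary terms.\<close>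

lemma card_bad_tail:
  assumes "2 * p i \<le> a" "a + M \<le> p (Suc i)" "j \<le> Suc i" "j > 0"
  shows "j * card (bad P \<inter> {a..<a+M}) \<le> 8 * j + 4 * M"
proof -
  \<comment> \<open>\<open>c\<close> is where the window meets the main part; \<open>L\<close>
    truncates to 0 if it ends before.\<close>
  define c where "c = max a (2 * p i + i)"
  define L where "L = a + M - c"
  have "bad P \<inter> {a..<a+M} \<subseteq> {2 * p i + i - P..<2 * p i + i} \<union> (bad P \<inter> {c..<c+L})"
    using assms bad_filler[of i] by (force simp: c_def L_def max_def)
  then have "card (bad P \<inter> {a..<a+M}) \<le> card ({2 * p i + i - P..<2 * p i + i} \<union> (bad P \<inter> {c..<c+L}))"
    by (rule card_mono[rotated]) auto
  also have "\<dots> \<le> card {2 * p i + i - P..<2 * p i + i} + card (bad P \<inter> {c..<c+L})" by (rule card_Un_le)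
  also have "card {2 * p i + i - P..<2 * p i + i} \<le> 2" using P by auto
  also have "card (bad P \<inter> {c..<c+L}) \<le> P + (L div Suc i + 1) * P"
  proof (cases "L = 0")
    case False
    then show ?thesis using assms P by (intro card_bad_main) (auto simp: c_def L_def)
  qed simp
  also have "\<dots> \<le> 2 + (L div Suc i + 1) * 2" using P by auto
  finally have "card (bad P \<inter> {a..<a+M}) \<le> 6 + 2 * (L div Suc i)" by simp
  moreover have "L div Suc i \<le> M div j" using assms
    by (intro order_trans[OF div_le_mono div_le_mono2]) (auto simp: L_def c_def)
  ultimately have "j * card (bad P \<inter> {a..<a+M}) \<le> j * (6 + 2 * (M div j))" by (intro mult_le_mono2) simp
  also have "\<dots> = 6 * j + 2 * (j * (M div j))" by (simp add: algebra_simps)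
  also have "\<dots> \<le> 8 * j + 4 * M" using div_times_less_eq_dividend[of M j] unfolding mult.commute[of j] by linarith
  finally show ?thesis .
qed

text \<open>The slack \<open>Q\<close> keeps the comparison positions \<open>n + Q\<close> inside
  the copied block.\<close>

lemma card_bad_copy:
  assumes "p i \<le> a" "a + M + Q \<le> 2 * p i"
  shows "card (bad Q \<inter> {a..<a+M}) = card (bad Q \<inter> {a - p i..<a - p i+M})"
proof -
  have "bad Q \<inter> {a..<a+M} = (\<lambda>n. n + p i) ` (bad Q \<inter> {a - p i..<a - p i+M})"
  proof (intro equalityI subsetI)
    fix n assume n: "n \<in> bad Q \<inter> {a..<a+M}"
    then have "n - p i \<in> bad Q \<inter> {a - p i..<a - p i+M}" using bad_copy[of i n Q] assms by auto
    then show "n \<in> (\<lambda>n. n + p i) ` (bad Q \<inter> {a - p i..<a - p i+M})" using n assms by (force intro: rev_image_eqI)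
  next
    fix n assume "n \<in> (\<lambda>n. n + p i) ` (bad Q \<inter> {a - p i..<a - p i+M})"
    then show "n \<in> bad Q \<inter> {a..<a+M}" using bad_copy[of i n Q] assms by auto
  qed
  then show ?thesis by (simp add: card_image)
qed

text \<open>Either the window is comparable to its position, and the density of the bad set decides, or
  it moves down inside a copy, or it straddles at most two zones; an end piece of a copied block is
  again an end piece of a main part, because main parts dominate their zones.\<close>

lemma card_bad_window:
  assumes "p (Suc j) \<le> M"
  shows "Suc j * card (bad P \<inter> {a..<a+M}) \<le> 200 * M"
proof (induction a rule: less_induct)
  case (less a)
  let ?w = "\<lambda>S. Suc j * card (bad P \<inter> S)"
  have jM: "Suc j \<le> M" using assms p_ge[of "Suc j"] by simp
  have split: "?w {u..<w} \<le> ?w {u..<v} + ?w {v..<w}" if "u \<le> v" for u v w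
    using mult_le_mono2[OF card_window_split[OF that, of "bad P" w], of "Suc j"] by (simp add: algebra_simps)
  have prefix: "?w {0..<q * M} \<le> 25 * (q * M)" if "q > 0" for q
    using that assms by (intro card_bad_prefix) (auto intro: order_trans)
  show ?case
  proof (cases "a \<le> 6 * M")
    case True
    \<comment> \<open>The window lies in the first \<open>7 * M\<close> positions; 7 * 25 = 175 is
      the largest demand on the constant 200.\<close>
    then have "?w {a..<a+M} \<le> ?w {0..<7 * M}" by (intro mult_le_mono2 card_mono) auto
    then show ?thesis using prefix[of 7] by simp
  next
    case a: False
    obtain i where i: "Suc j \<le> i" "p i \<le> a" "a < p (Suc i)"
      using zone_exists[of "Suc j" a] a assms by auto
    have ends: "?w {c..<d} \<le> 12 * M" if "2 * p l \<le> c" "d \<le> p (Suc l)" "j \<le> l" "c \<le> d" "d \<le> c + M" for c d l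
      using card_bad_tail[of l c "d - c" "Suc j"] that jM by simp
    have low: "i = Suc (i - 1)" "j \<le> i - 1" "j \<le> i" using i(1) by auto
    \<comment> \<open>Relative to zone \<open>i\<close>, the window is past the copy and within the
      zone, past the copy and overhanging the zone's end, well inside the copy, or at the seam
      \<open>2 * p i\<close>.\<close>
    consider "2 * p i \<le> a" "a + M \<le> p (Suc i)" | "2 * p i \<le> a" "p (Suc i) < a + M"
      | "a < 2 * p i" "a + M + P \<le> 2 * p i" | "a < 2 * p i" "2 * p i < a + M + P" by linarith
    then show ?thesis
    proof cases
      case 1
      then show ?thesis using ends[of i a "a + M"] low by simp
    next
      case 2
      define r where "r = p (Suc i)"
      have "?w {a..<a+M} \<le> ?w {a..<r} + ?w {r..<a+M}" using i(3) by (intro split) (simp add: r_def)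
      also have "?w {a..<r} \<le> 12 * M" using 2 ends[of i a r] low i(3) by (simp add: r_def)
      also have "?w {r..<a+M} \<le> ?w {r..<r+M}" using i(3) by (intro mult_le_mono2 card_mono) (auto simp: r_def)
      \<comment> \<open>As \<open>6 * M < a < p (Suc i)\<close>, the overhang, enlarged to length
        \<open>M\<close>, fits into the next copy and has the count of a prefix.\<close>
      also have "card (bad P \<inter> {r..<r+M}) = card (bad P \<inter> {0..<M})"
        using card_bad_copy[of "Suc i" r M P] a i(3) P jM by (auto simp: r_def)
      also have "Suc j * \<dots> \<le> 25 * M" using prefix[of 1] by simp
      finally show ?thesis by simp
    next
      case 3
      have "p i > 0" using p_ge[of i] by simp
      moreover have "a > 0" using a by simp
      ultimately have "a - p i < a" by simp
      then show ?thesis using less[of "a - p i"] card_bad_copy[of i a M P] 3 i(2) by (simp only:)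
    next
      case 4
      \<comment> \<open>The last \<open>P\<close> positions of the copy compare with symbols beyond
        it; they are split off and counted in full.\<close>
      define c where "c = max a (2 * p i - P)"
      have p_i: "10 * p (i - 1) \<le> p i" "p i \<ge> 10"
        using p_Suc_ge[of "i - 1"] p_ge[of "i - 1"] low(1) by auto
      have c: "a \<le> c" "c \<le> 2 * p i" "2 * p i \<le> c + 2" "c \<le> a + M" using 4 P by (auto simp: c_def)
      \<comment> \<open>Since \<open>M < a / 6\<close>, the start \<open>a\<close> is so far into
        the copy that \<open>a - p i\<close> is past the copy part of zone
        \<open>i - 1\<close>.\<close>
      have "6 * p i \<le> 5 * a" using a 4 P p_i by auto
      then have a': "2 * p (i - 1) \<le> a - p i" using p_i(1) by linarith
      have "?w {a..<a+M} \<le> ?w {a..<c} + ?w {c..<a+M}" using c by (intro split)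
      also have "?w {c..<a+M} \<le> ?w {c..<2 * p i} + ?w {2 * p i..<a+M}" using c by (intro split)
      also have "?w {2 * p i..<a+M} \<le> 12 * M"
      proof (cases "2 * p i \<le> a + M")
        case True
        then show ?thesis using ends[of i "2 * p i" "a + M"] low(3) 4 a p_Suc_ge[of i] by linarith
      qed simp
      also have "?w {c..<2 * p i} \<le> Suc j * card {c..<2 * p i}" by (intro mult_le_mono2 card_mono) auto
      also have "\<dots> \<le> Suc j * 2" using c(3) by (intro mult_le_mono2) simp
      also have "?w {a..<c} \<le> 12 * M"
      proof (cases "a = c")
        case False
        then have "c = 2 * p i - P" "a < c" using c(1) by (auto simp: c_def max_def split: if_splits)
        then have "card (bad P \<inter> {a..<c}) = card (bad P \<inter> {a - p i..<c - p i})"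
          using card_bad_copy[of i a "c - a" P] i(2) by simp
        moreover have "?w {a - p i..<c - p i} \<le> 12 * M"
          using ends[of "i - 1" "a - p i" "c - p i"] a' c low i(2) by simp
        ultimately show ?thesis by simp
      qed simp
      finally show ?thesis using jM by simp
    qed
  qed
qed

section \<open>From rare bad positions to restrictions on the limit sets\<close>

lemma ex_zone_fine:
  assumes "e > (0::real)"
  obtains j where "C \<le> e * Suc j"
proof -
  obtain j where "C / e \<le> real j" using real_arch_simple by blast
  then have "C \<le> e * real j" using assms by (simp add: field_simps)
  also have "\<dots> \<le> e * Suc j" using assms by simp
  finally show ?thesis using that by blast
qed

text \<open>Converts the integer estimates with factor \<open>Suc j\<close> into density bounds,
  once \<open>j\<close> is so large that \<open>C / Suc j \<le> e\<close>.\<close>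

lemma ratio_le_if_zone:
  fixes e :: real
  assumes "Suc j * c \<le> C * n" "real C \<le> e * Suc j"
  shows "real c \<le> e * real n"
proof -
  have "Suc j * real c \<le> C * real n" using assms(1) by (simp only: of_nat_mult[symmetric] of_nat_le_iff)
  also have "\<dots> \<le> (e * real (Suc j)) * real n" using assms(2) by (intro mult_right_mono) auto
  also have "\<dots> = real (Suc j) * (e * real n)" by (simp only: mult_ac)
  finally have "real (Suc j) * real c \<le> real (Suc j) * (e * real n)" .
  then show ?thesis by (simp only: mult_le_cancel_left_pos of_nat_0_less_iff zero_less_Suc)
qed

lemma bad_banach_zero:
  assumes "e > (0::real)"
  shows "\<forall>\<^sub>F m in sequentially. \<forall>a. card (bad P \<inter> {a..<a+m}) \<le> e * real m"
proof -
  obtain j where j: "real 200 \<le> e * Suc j" using ex_zone_fine[OF assms] by blast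
  show ?thesis
    using eventually_ge_at_top[of "p (Suc j)"]
    by eventually_elim (use card_bad_window ratio_le_if_zone[OF _ j] in blast)
qed

lemma bad_density_zero:
  assumes "e > (0::real)"
  shows "\<forall>\<^sub>F n in sequentially. card (bad 1 \<inter> {0..<n}) \<le> e * real n"
proof -
  obtain j where j: "real 12 \<le> e * Suc j" using ex_zone_fine[OF assms] by blast
  show ?thesis
    using eventually_ge_at_top[of "p (Suc j)"]
    by eventually_elim (use card_bad1_prefix ratio_le_if_zone[OF _ j] in blast)
qed

text \<open>If \<open>y\<close> breaks the rule at \<open>n\<close>, each occurrence of its prefix
  causes a bad position \<open>n\<close> places later; length \<open>n + Q + 1\<close> covers both
  coordinates compared.\<close>

lemma card_occ_le_bad:
  assumes "\<not> (y n < 2 \<and> y n = y (n + Q))"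
  shows "card (occ x y (n + Q + 1) \<inter> {a..<a+m}) \<le> card (bad Q \<inter> {a+n..<a+n+m})"
proof (rule card_inj_on_le[of "\<lambda>t. t + n"])
  show "(\<lambda>t. t + n) ` (occ x y (n + Q + 1) \<inter> {a..<a+m}) \<subseteq> bad Q \<inter> {a+n..<a+n+m}"
  proof
    fix t assume "t \<in> (\<lambda>t. t + n) ` (occ x y (n + Q + 1) \<inter> {a..<a+m})"
    then obtain s where s: "t = s + n" "s \<in> occ x y (n + Q + 1)" "s \<in> {a..<a+m}" by auto
    then have "x (s + n) = y n" "x (s + (n + Q)) = y (n + Q)" by (auto simp: occ_def)
    then show "t \<in> bad Q \<inter> {a+n..<a+n+m}" using s assms by (auto simp: bad_def add.assoc)
  qed
qed auto

lemma upper_banach_periodic: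
  assumes "upper_banach (occ x y (n + P + 1)) > 0"
  shows "y n < 2 \<and> y n = y (n + P)"
proof (rule ccontr)
  assume "\<not> ?thesis"
  note le = card_occ_le_bad[OF this]
  have "\<not> upper_banach (occ x y (n + P + 1)) > 0"
  proof (rule upper_banach_not_pos)
    fix e :: real assume "e > 0"
    from bad_banach_zero[OF this]
    show "\<forall>\<^sub>F m in sequentially. \<forall>a. card (occ x y (n + P + 1) \<inter> {a..<a+m}) \<le> e * real m"
      by eventually_elim (use le of_nat_mono order_trans in blast)
  qed
  then show False using assms by simp
qed

lemma upper_density_const:
  assumes "upper_density (occ x y (n + 1 + 1)) > 0"
  shows "y n < 2 \<and> y n = y (n + 1)"
proof (rule ccontr)
  assume "\<not> ?thesis"
  note le = card_occ_le_bad[OF this, of 0, simplified]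
  have "\<not> upper_density (occ x y (n + 1 + 1)) > 0"
  proof (rule upper_density_not_pos)
    fix e :: real assume e: "e > 0"
    \<comment> \<open>Half of \<open>e\<close> pays for the shift by \<open>n\<close>: for
      \<open>m \<ge> n\<close> the prefix grows to at most \<open>2 * m\<close>.\<close>
    then have ev: "\<forall>\<^sub>F m in sequentially. card (bad 1 \<inter> {0..<m}) \<le> (e / 2) * real m"
      using bad_density_zero[of "e / 2"] by simp
    have "\<forall>\<^sub>F m in sequentially. card (bad 1 \<inter> {0..<m + n}) \<le> (e / 2) * real (m + n)"
      using ev filterlim_add_const_nat_at_top by (rule eventually_compose_filterlim)
    then show "\<forall>\<^sub>F m in sequentially. card (occ x y (n + 1 + 1) \<inter> {0..<m}) \<le> e * real m"
      using eventually_ge_at_top[of n]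
    proof eventually_elim
      case (elim m)
      have "card (occ x y (n + 1 + 1) \<inter> {0..<m}) \<le> card (bad 1 \<inter> {n..<n+m})"
        using le[of m] by simp
      also have "\<dots> \<le> card (bad 1 \<inter> {0..<m+n})" by (intro card_mono) auto
      finally have "real (card (occ x y (n + 1 + 1) \<inter> {0..<m})) \<le> (e / 2) * real (m + n)"
        using elim(1) by linarith
      also have "\<dots> \<le> (e / 2) * (2 * real m)" using elim(2) e by (intro mult_left_mono) auto
      finally show ?case by simp
    qed
  qed
  then show False using assms by simp
qed

section \<open>Long runs, fillers and recurrence\<close>

subsection \<open>Runs in the main parts\<close>

text \<open>Each period of \<open>2 * Suc j\<close> positions contains a block of \<open>c\<close>,
  and at least half of that block's positions start a run of length \<open>m\<close>. This gives
  density 1/4 up to one incomplete period.\<close>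

lemma card_run_window:
  assumes c: "alt j \<or> b j = c" "c < 2" and m: "2 * m \<le> Suc j"
    and A: "2 * p j + j \<le> A" "A + M + m \<le> p (Suc j)"
  shows "M \<le> 4 * card (occ x (\<lambda>_. c) m \<inter> {A..<A+M}) + 2 * Suc j"
proof -
  define r where "r = Suc j"
  \<comment> \<open>The parity of the blocks that carry \<open>c\<close> when the main part
    alternates.\<close>
  define s where "s = (if b j = c then 0 else 1 :: nat)"
  let ?R = "{s * r..<s * r + (r - m)}" and ?S = "occ x (\<lambda>_. c) m \<inter> {A..<A+M}"
  have "{n \<in> {A..<A+M}. n mod (2 * r) \<in> ?R} \<subseteq> ?S"
  proof
    fix n assume n: "n \<in> {n \<in> {A..<A+M}. n mod (2 * r) \<in> ?R}"
    have "x (n + i) = c" if "i < m" for i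
    proof -
      define q where "q = n div (2 * r)"
      have "n = 2 * r * q + n mod (2 * r)" by (simp add: q_def)
      then have "r * (2 * q + s) \<le> n + i" "n + i < r * Suc (2 * q + s)"
        using n that m by (auto simp: r_def algebra_simps)
      then have "(n + i) div r = 2 * q + s" by (rule div_nat_eqI)
      moreover have "(b j + (2 * q + s)) mod 2 = c" if "alt j"
        using c(2) b_less[of j] by (cases "b j = 0"; cases "c = 0") (auto simp: s_def less_2_cases_iff)
      ultimately show ?thesis using main[of j "n + i"] n A c(1) that by (auto simp: r_def)
    qed
    moreover have "n \<ge> 1" using n A p_ge[of j] by auto
    ultimately show "n \<in> ?S" using n by (auto simp: occ_def)
  qed
  then have le: "card {n \<in> {A..<A+M}. n mod (2 * r) \<in> ?R} \<le> card ?S" by (rule card_mono[rotated]) auto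
  have "(M div (2 * r)) * card ?R \<le> card {n \<in> {A..<A+M}. n mod (2 * r) \<in> ?R}"
    by (rule card_residue_ge) (auto simp: s_def)
  with le have "(M div (2 * r)) * (r - m) \<le> card ?S" by simp
  then have "4 * ((M div (2 * r)) * (r - m)) \<le> 4 * card ?S" by (rule mult_le_mono2)
  moreover have "(M div (2 * r)) * (2 * r) \<le> (M div (2 * r)) * (4 * (r - m))"
    using m unfolding r_def by (intro mult_le_mono2) simp
  moreover have "(M div (2 * r)) * (4 * (r - m)) = 4 * ((M div (2 * r)) * (r - m))" by (simp only: mult_ac)
  ultimately have "(M div (2 * r)) * (2 * r) \<le> 4 * card ?S" by (simp only:)
  moreover have "M < (M div (2 * r)) * (2 * r) + 2 * r" 
    using dividend_less_div_times[of "2 * r" M] by (simp only: add.commute) (simp add: r_def)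
  ultimately show ?thesis by (simp add: r_def)
qed

text \<open>Copy, filler and boundary losses come to at most \<open>5.5 * p j\<close>, and the
  growth factor of at least 10 leaves enough of \<open>p (Suc j)\<close> for the density 1/4 to act
  on.\<close>

lemma card_run_at_p:
  assumes "alt j \<or> b j = c" "c < 2" "2 * m \<le> Suc j"
  shows "p (Suc j) \<le> 10 * card (occ x (\<lambda>_. c) m \<inter> {0..<p (Suc j)})"
proof -
  define A where "A = 2 * p j + j"
  define M where "M = p (Suc j) - m - A"
  have ge: "A + M + m = p (Suc j)" using p_Suc_ge[of j] p_ge[of j] assms(3) by (simp add: A_def M_def)
  then have "M \<le> 4 * card (occ x (\<lambda>_. c) m \<inter> {A..<A+M}) + 2 * Suc j"
    using assms by (intro card_run_window) (auto simp: A_def)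
  moreover have "card (occ x (\<lambda>_. c) m \<inter> {A..<A+M}) \<le> card (occ x (\<lambda>_. c) m \<inter> {0..<p (Suc j)})"
    using ge by (intro card_mono) auto
  ultimately show ?thesis using ge p_Suc_ge[of j] p_ge[of j] assms(3) A_def by simp
qed

lemma card_run_prefix:
  assumes run: "\<And>i. j \<le> i \<Longrightarrow> alt i \<or> b i = c" and "c < 2" "2 * m \<le> Suc j" and n: "p (Suc j) \<le> n"
  shows "n \<le> 200 * card (occ x (\<lambda>_. c) m \<inter> {0..<n})"
proof -
  obtain i where i: "Suc j \<le> i" "p i \<le> n" "n < p (Suc i)" using zone_exists[OF n] .
  then obtain l where l: "i = Suc l" "j \<le> l" by (cases i) auto
  \<comment> \<open>Up to \<open>20 * p i\<close> the count at \<open>p i\<close> suffices, giving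
    200 = 20 * 10; beyond that, the main part of zone \<open>i\<close> itself contributes.\<close>
  show ?thesis
  proof (cases "n \<le> 20 * p i")
    case True
    have "p i \<le> 10 * card (occ x (\<lambda>_. c) m \<inter> {0..<p i})"
      unfolding l using assms l by (intro card_run_at_p) auto
    moreover have "card (occ x (\<lambda>_. c) m \<inter> {0..<p i}) \<le> card (occ x (\<lambda>_. c) m \<inter> {0..<n})"
      using i by (intro card_mono) auto
    ultimately show ?thesis using True by linarith
  next
    case False
    define A where "A = 2 * p i + i"
    define M where "M = n - m - A"
    have ge: "A + M + m = n" using False p_ge[of i] assms(3) i by (simp add: A_def M_def)
    then have "M \<le> 4 * card (occ x (\<lambda>_. c) m \<inter> {A..<A+M}) + 2 * Suc i"
      using assms i by (intro card_run_window) (auto simp: A_def)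
    moreover have "card (occ x (\<lambda>_. c) m \<inter> {A..<A+M}) \<le> card (occ x (\<lambda>_. c) m \<inter> {0..<n})"
      using ge by (intro card_mono) auto
    ultimately show ?thesis using ge p_ge[of i] assms(3) i(1) False A_def by simp
  qed
qed

lemma frequently_p:
  assumes "\<exists>\<^sub>F j in sequentially. Q (p (Suc j))"
  shows "\<exists>\<^sub>F n in sequentially. Q n"
  unfolding frequently_sequentially
proof
  fix N
  obtain j where "N \<le> j" "Q (p (Suc j))" using assms by (auto simp: frequently_sequentially)
  moreover have "j \<le> p (Suc j)" using p_ge[of "Suc j"] by simp
  ultimately show "\<exists>n\<ge>N. Q n" by (intro exI[of _ "p (Suc j)"]) auto
qed

lemma run_upper_density:
  assumes "\<exists>\<^sub>F j in sequentially. alt j \<or> b j = c" "c < 2"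
  shows "upper_density (occ x (\<lambda>_. c) m) > 0"
proof (rule upper_density_pos[of "1/10"])
  have "\<exists>\<^sub>F j in sequentially. (1/10) * real (p (Suc j)) \<le> card (occ x (\<lambda>_. c) m \<inter> {0..<p (Suc j)})"
    using assms(1)
  proof (rule frequently_rev_mp, intro eventually_mono[OF eventually_ge_at_top[of "2 * m"]] impI)
    fix j assume "2 * m \<le> j" "alt j \<or> b j = c"
    then have "p (Suc j) \<le> 10 * card (occ x (\<lambda>_. c) m \<inter> {0..<p (Suc j)})"
      using assms(2) by (intro card_run_at_p) auto
    then show "(1/10) * real (p (Suc j)) \<le> card (occ x (\<lambda>_. c) m \<inter> {0..<p (Suc j)})" by linarith
  qed
  then show "\<exists>\<^sub>F n in sequentially. (1/10) * real n \<le> card (occ x (\<lambda>_. c) m \<inter> {0..<n})"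
    by (rule frequently_p)
qed simp

lemma run_lower_density:
  assumes "\<forall>\<^sub>F j in sequentially. alt j \<or> b j = c" "c < 2"
  shows "lower_density (occ x (\<lambda>_. c) m) > 0"
proof (rule lower_density_pos[of "1/200"])
  obtain J where J: "\<And>i. J \<le> i \<Longrightarrow> alt i \<or> b i = c" using assms(1) by (auto simp: eventually_sequentially)
  show "\<forall>\<^sub>F n in sequentially. (1/200) * real n \<le> card (occ x (\<lambda>_. c) m \<inter> {0..<n})"
    \<comment> \<open>The offset \<open>2 * m\<close> makes the blocks at least twice as long as the
      runs sought.\<close>
    using eventually_ge_at_top[of "p (Suc (J + 2 * m))"]
  proof eventually_elim
    case (elim n)
    have "n \<le> 200 * card (occ x (\<lambda>_. c) m \<inter> {0..<n})"
      using J assms(2) elim by (intro card_run_prefix[of "J + 2 * m"]) auto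
    then show ?case by linarith
  qed
qed simp

text \<open>A constant main part with the wrong symbol confines the occurrences before
  \<open>p (Suc j)\<close> to the first \<open>2 * p j + j\<close> positions, a share tending to
  0.\<close>

lemma run_lower_density_not:
  assumes "\<exists>\<^sub>F j in sequentially. \<not> alt j \<and> b j \<noteq> y 0"
  shows "\<not> lower_density (occ x y 1) > 0"
proof (rule lower_density_not_pos)
  fix e :: real assume "e > 0"
  then obtain J where J: "real 3 \<le> e * Suc J" using ex_zone_fine by blast
  have "\<exists>\<^sub>F j in sequentially. card (occ x y 1 \<inter> {0..<p (Suc j)}) \<le> e * real (p (Suc j))"
    using assms(1)
  proof (rule frequently_rev_mp, intro eventually_mono[OF eventually_ge_at_top[of J]] impI)
    fix j assume j: "J \<le> j" "\<not> alt j \<and> b j \<noteq> y 0"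
    have "occ x y 1 \<inter> {0..<p (Suc j)} \<subseteq> {0..<2 * p j + j}"
      proof
      fix n assume n: "n \<in> occ x y 1 \<inter> {0..<p (Suc j)}"
      then have "x n = y 0" by (auto simp: occ_def)
      then show "n \<in> {0..<2 * p j + j}" using j(2) main[of j n] n by (cases "2 * p j + j \<le> n") auto
    qed
    from card_mono[OF _ this] have "card (occ x y 1 \<inter> {0..<p (Suc j)}) \<le> 2 * p j + j" by simp
    also have "\<dots> \<le> 3 * p j" using p_ge[of j] by simp
    finally have "Suc J * card (occ x y 1 \<inter> {0..<p (Suc j)}) \<le> Suc J * (3 * p j)" by (rule mult_le_mono2)
    also have "\<dots> \<le> 3 * p (Suc j)" using j(1) by (simp add: p_Suc mult_le_mono1 del: mult_Suc)
    finally show "card (occ x y 1 \<inter> {0..<p (Suc j)}) \<le> e * real (p (Suc j))"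
      by (rule ratio_le_if_zone[OF _ J])
  qed
  then show "\<exists>\<^sub>F n in sequentially. card (occ x y 1 \<inter> {0..<n}) \<le> e * real n" by (rule frequently_p)
qed

lemma run_exists:
  assumes "\<exists>\<^sub>F j in sequentially. alt j \<or> b j = c" "c < 2"
  obtains a where "\<And>i. i < m \<Longrightarrow> x (a + i) = c"
proof -
  have "upper_banach (occ x (\<lambda>_. c) m) > 0"
    using run_upper_density[OF assms] upper_density_le_banach by (rule less_le_trans)
  from infinite_imp_nonempty[OF upper_banach_pos_imp_infinite[OF this]]
  obtain a where "a \<in> occ x (\<lambda>_. c) m" by auto
  then show ?thesis using that by (auto simp: occ_def)
qed

text \<open>A run of \<open>c\<close> of length \<open>m + i\<close> excludes \<open>m\<close>
  consecutive starting positions, as coordinate \<open>i\<close> would have to equal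
  \<open>c\<close>.\<close>

lemma lower_banach_not_pos_if_run:
  assumes "\<exists>\<^sub>F j in sequentially. alt j \<or> b j = c" "c < 2" "y i \<noteq> c"
  shows "\<not> lower_banach (occ x y (Suc i)) > 0"
proof (rule lower_banach_not_pos)
  fix m
  obtain a where a: "\<And>t. t < m + i \<Longrightarrow> x (a + t) = c" using run_exists[OF assms(1,2)] by blast
  have "x (n + i) = c" if "n \<in> {a..<a+m}" for n
    using a[of "n + i - a"] that by auto
  then show "\<exists>a. occ x y (Suc i) \<inter> {a..<a+m} = {}"
    using assms(3) by (intro exI[of _ a]) (force simp: occ_def)
qed

lemma filler_upper_banach: "upper_banach (occ x (\<lambda>n. n mod P) m) > 0"
proof (rule upper_banach_pos[of "1/4"])
  show "\<exists>\<^sub>F M in sequentially. \<exists>a. (1/4) * real M \<le> card (occ x (\<lambda>n. n mod P) m \<inter> {a..<a+M})"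
  proof (rule eventually_frequently[OF _ eventually_mono[OF eventually_ge_at_top[of 2]]])
    fix M :: nat assume "2 \<le> M"
    \<comment> \<open>A filler of this length has room for \<open>M\<close> starting positions, each
      followed by \<open>m\<close> symbols.\<close>
    define j where "j = M + m"
    define a where "a = 2 * p j"
    \<comment> \<open>Even positions start the pattern in phase for both values of
      \<open>P\<close>.\<close>
    have "{n \<in> {a..<a+M}. n mod 2 \<in> {0}} \<subseteq> occ x (\<lambda>n. n mod P) m \<inter> {a..<a+M}"
    proof
      fix n assume n: "n \<in> {n \<in> {a..<a+M}. n mod 2 \<in> {0}}"
      have "x (n + i) = i mod P" if "i < m" for i
      proof -
        have "x (n + i) = (n + i) mod P" using n that by (intro filler[of j]) (auto simp: a_def j_def)
        also have "\<dots> = (n mod P + i) mod P" by (simp only: mod_add_left_eq)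
        also have "n mod P = 0" using n P by auto
        finally show ?thesis by simp
      qed
      moreover have "n \<ge> 1" using n p_ge[of j] by (auto simp: a_def)
      ultimately show "n \<in> occ x (\<lambda>n. n mod P) m \<inter> {a..<a+M}" using n by (auto simp: occ_def)
    qed
    then have "card {n \<in> {a..<a+M}. n mod 2 \<in> {0}} \<le> card (occ x (\<lambda>n. n mod P) m \<inter> {a..<a+M})"
      by (rule card_mono[rotated]) auto
    moreover have "M div 2 * card {0::nat} \<le> card {n \<in> {a..<a+M}. n mod 2 \<in> {0}}"
      by (rule card_residue_ge) auto
    ultimately have "M div 2 \<le> card (occ x (\<lambda>n. n mod P) m \<inter> {a..<a+M})" by simp
    then show "\<exists>a. (1/4) * real M \<le> card (occ x (\<lambda>n. n mod P) m \<inter> {a..<a+M})"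
      using \<open>2 \<le> M\<close> by (intro exI[of _ a]) linarith
  qed simp
qed simp

text \<open>Each zone begins with a copy of all that precedes it, so the first \<open>m\<close>
  symbols recur at \<open>p j\<close> for every \<open>j \<ge> m\<close>.\<close>

lemma occ_self_infinite: "infinite (occ x x m)"
  unfolding infinite_nat_iff_unbounded_le
proof
  fix N
  define j where "j = max N m"
  have "p j \<in> occ x x m" using copy[of j] p_ge[of j] by (auto simp: occ_def j_def)
  moreover have "N \<le> p j" using p_ge[of j] by (simp add: j_def)
  ultimately show "\<exists>n\<ge>N. n \<in> occ x x m" by blast
qed

section \<open>Computation of the five limit sets\<close>

subsection \<open>The limit sets\<close>

context
  fixes k :: nat
  assumes x_Sigma: "x \<in> Sigma k" and k: "k \<ge> 2"
    and both: "\<And>c. c < 2 \<Longrightarrow> \<exists>\<^sub>F j in sequentially. alt j \<or> b j = c"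
begin

text \<open>Rarity of \<open>bad 1\<close> leaves only the constants 0 and 1; runs in infinitely
  many zones realize both.\<close>

lemma omega_upper_density: "omega_xi upper_density k x = {\<lambda>_. 0, \<lambda>_. 1}"
proof (intro equalityI subsetI)
  fix y assume "y \<in> omega_xi upper_density k x"
  then have step: "y n < 2 \<and> y n = y (n + 1)" for n
    by (intro upper_density_const) (simp add: omega_xi_iff[OF mono_upper_density x_Sigma])
  have "y n = y 0" for n by (induction n) (use step in auto)
  moreover have "y 0 = 0 \<or> y 0 = 1" using step[of 0] by auto
  ultimately show "y \<in> {\<lambda>_. 0, \<lambda>_. 1}" by (auto simp: fun_eq_iff)
next
  have "(\<lambda>_. c) \<in> omega_xi upper_density k x" if "c < 2" for c
    using run_upper_density[OF both[OF that] that] that k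
    by (auto simp: omega_xi_iff[OF mono_upper_density x_Sigma] Sigma_def)
  then show "y \<in> omega_xi upper_density k x" if "y \<in> {\<lambda>_. 0, \<lambda>_. 1}" for y using that by auto
qed

lemma omega_lower_banach: "omega_xi lower_banach k x = {}"
proof -
  have False if y: "y \<in> omega_xi lower_banach k x" for y
  proof -
    \<comment> \<open>Long runs of a symbol other than \<open>y 0\<close> exclude
      \<open>y\<close>.\<close>
    define c :: nat where "c = (if y 0 = 0 then 1 else 0)"
    have "c < 2" "y 0 \<noteq> c" by (auto simp: c_def)
    then have "\<not> lower_banach (occ x y (Suc 0)) > 0"
      by (intro lower_banach_not_pos_if_run[of c] both)
    then show False using y omega_xi_iff[OF mono_lower_banach x_Sigma] by blast
  qed
  then show ?thesis by blast
qed

text \<open>Only the two constants of the upper density limit set are candidates; infinitely many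
  constant main parts with the other symbol are the sole obstruction.\<close>

lemma omega_lower_density:
  "omega_xi lower_density k x = {\<lambda>_. c | c. c < 2 \<and> (\<forall>\<^sub>F j in sequentially. alt j \<or> b j = c)}"
proof (intro equalityI subsetI)
  fix y assume "y \<in> omega_xi lower_density k x"
  then have y: "lower_density (occ x y m) > 0" "y \<in> Sigma k" for m
    by (auto simp: omega_xi_iff[OF mono_lower_density x_Sigma])
  have "upper_density (occ x y m) > 0" for m
    using y(1) lower_le_upper_density by (rule less_le_trans)
  then have "y \<in> omega_xi upper_density k x"
    using y(2) by (simp add: omega_xi_iff[OF mono_upper_density x_Sigma])
  then have "y \<in> (\<lambda>c _. c) ` {0, 1}" unfolding omega_upper_density by simp
  then obtain c where "c \<in> {0, 1}" and y_eq: "y = (\<lambda>_. c)" by blast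
  then have c: "c < 2" by auto
  have "\<not> (\<exists>\<^sub>F j in sequentially. \<not> alt j \<and> b j \<noteq> y 0)" using run_lower_density_not y(1) by blast
  then show "y \<in> {\<lambda>_. c | c. c < 2 \<and> (\<forall>\<^sub>F j in sequentially. alt j \<or> b j = c)}"
    using c y_eq by (auto simp: frequently_def)
next
  fix y :: "nat \<Rightarrow> nat" assume "y \<in> {\<lambda>_. c | c. c < 2 \<and> (\<forall>\<^sub>F j in sequentially. alt j \<or> b j = c)}"
  then obtain c where c: "y = (\<lambda>_. c)" "c < 2" "\<forall>\<^sub>F j in sequentially. alt j \<or> b j = c" by blast
  then show "y \<in> omega_xi lower_density k x"
    using run_lower_density[OF c(3,2)] k by (auto simp: omega_xi_iff[OF mono_lower_density x_Sigma] Sigma_def)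
qed

lemma omega_upper_banach_periodic:
  assumes "y \<in> omega_xi upper_banach k x"
  shows "y n < 2 \<and> y n = y (n + P)"
  using assms by (intro upper_banach_periodic) (simp add: omega_xi_iff[OF mono_upper_banach x_Sigma])

lemma upper_density_subset_banach: "omega_xi upper_density k x \<subseteq> omega_xi upper_banach k x"
  using less_le_trans[OF _ upper_density_le_banach]
  by (auto simp: omega_xi_iff[OF mono_upper_density x_Sigma] omega_xi_iff[OF mono_upper_banach x_Sigma])

lemma omega_upper_banach_1:
  assumes "P = 1"
  shows "omega_xi upper_banach k x = omega_xi upper_density k x"
proof
  show "omega_xi upper_banach k x \<subseteq> omega_xi upper_density k x"
  proof
    fix y assume "y \<in> omega_xi upper_banach k x"
    then have step: "y n < 2 \<and> y n = y (n + 1)" for n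
      using omega_upper_banach_periodic assms by blast
    have "y n = y 0" for n by (induction n) (use step in auto)
    moreover have "y 0 = 0 \<or> y 0 = 1" using step[of 0] by auto
    ultimately show "y \<in> omega_xi upper_density k x"
      unfolding omega_upper_density by (auto simp: fun_eq_iff)
  qed
qed (rule upper_density_subset_banach)

text \<open>The alternating sequence of the fillers is the additional point.\<close>

lemma omega_upper_banach_2:
  assumes "P = 2"
  shows "omega_xi upper_density k x \<subset> omega_xi upper_banach k x"
proof
  show "omega_xi upper_density k x \<subseteq> omega_xi upper_banach k x" by (rule upper_density_subset_banach)
  have "n mod P < k" for n using assms k by (auto intro: less_le_trans[of _ 2])
  then have "(\<lambda>n. n mod P) \<in> omega_xi upper_banach k x"
    using filler_upper_banach by (auto simp: omega_xi_iff[OF mono_upper_banach x_Sigma] Sigma_def)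
  moreover have "(\<lambda>n. n mod P) \<notin> omega_xi upper_density k x"
  proof
    assume "(\<lambda>n. n mod P) \<in> omega_xi upper_density k x"
    moreover have "f 0 = f 1" if "f \<in> {\<lambda>_. 0, \<lambda>_. 1}" for f :: "nat \<Rightarrow> nat" using that by auto
    ultimately have "0 mod P = 1 mod P" unfolding omega_upper_density by blast
    then show False using assms by simp
  qed
  ultimately show "omega_xi upper_density k x \<noteq> omega_xi upper_banach k x" by blast
qed

text \<open>Membership would make \<open>x\<close> itself periodic with period
  \<open>P \<le> 2\<close>. Any two adjacent positions then determine all of \<open>x\<close>, yet
  both 00 and 11 occur.\<close>

lemma x_notin_omega_upper_banach: "x \<notin> omega_xi upper_banach k x"
proof
  assume "x \<in> omega_xi upper_banach k x"
  then have step: "x n = x (n + P)" for n using omega_upper_banach_periodic by blast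
  have mult: "x (r + q * P) = x r" for r q
  proof (induction q)
    case (Suc q)
    have "r + Suc q * P = (r + q * P) + P" by simp
    then show ?case using step[of "r + q * P"] Suc by (simp only:)
  qed simp
  have mod: "x n = x (n mod P)" for n
    using mult[of "n mod P" "n div P"] by (simp add: mod_div_mult_eq)
  have const: "x n = c" if c: "c < 2" for n c
  proof -
    obtain a where a: "\<And>i. i < 2 \<Longrightarrow> x (a + i) = c" by (rule run_exists[OF both[OF c] c, where m = 2]) blast
    have "n mod P = a mod P \<or> n mod P = (a + 1) mod P" using P
    proof
      assume "P = 2"
      show ?thesis unfolding \<open>P = 2\<close> by presburger
    qed simp
    then have "x n = x a \<or> x n = x (a + 1)" using mod[of n] mod[of a] mod[of "a + 1"] by auto
    then show ?thesis using a[of 0] a[of 1] by auto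
  qed
  show False using const[of 0 0] const[of 1 0] by simp
qed

text \<open>The recurrent point \<open>x\<close> itself separates the two sets.\<close>

lemma omega_upper_banach_omega_shift: "omega_xi upper_banach k x \<subset> omega_shift k x"
proof
  show "omega_xi upper_banach k x \<subseteq> omega_shift k x"
    by (auto simp: omega_xi_iff[OF mono_upper_banach x_Sigma]
        intro!: in_omega_shift_if[OF x_Sigma] upper_banach_pos_imp_infinite)
  have "x \<in> omega_shift k x" by (rule in_omega_shift_if[OF x_Sigma x_Sigma occ_self_infinite])
  then show "omega_xi upper_banach k x \<noteq> omega_shift k x" using x_notin_omega_upper_banach by blast
qed

lemma x_in_Rec_not_BR: "x \<in> Rec k - BR k"
proof -
  have "hits x (sball k x e) \<noteq> {}" if "e > 0" for e
  proof -
    obtain m where "1 / 2 ^ m < e" using ex_half_power_less \<open>e > 0\<close> by blast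
    then have "occ x x m \<subseteq> hits x (sball k x e)" by (rule occ_subset_hits[OF x_Sigma])
    then show ?thesis using occ_self_infinite[of m] by auto
  qed
  then show ?thesis using x_Sigma x_notin_omega_upper_banach by (auto simp: Rec_def BR_def omega_xi_def)
qed

text \<open>The lower density limit set consists of both constants in cases 1 and 2, of neither in 3
  and 5, and of the constant 0 alone in 4 and 6. The period \<open>P\<close> decides whether the
  upper Banach set exceeds the upper density set.\<close>

lemma case_prime_if:
  assumes "P = (if i \<in> {1, 3, 4} then 1 else 2)"
    and alternating: "i \<in> {1, 2} \<Longrightarrow> \<forall>\<^sub>F j in sequentially. alt j"
    and steady: "\<And>c. i \<in> {3, 5} \<Longrightarrow> c < 2 \<Longrightarrow> \<exists>\<^sub>F j in sequentially. \<not> alt j \<and> b j \<noteq> c"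
    and mixed: "i \<in> {4, 6} \<Longrightarrow> \<forall>\<^sub>F j in sequentially. alt j \<or> b j = 0"
      "i \<in> {4, 6} \<Longrightarrow> \<exists>\<^sub>F j in sequentially. \<not> alt j \<and> b j \<noteq> 1"
  shows "case_prime i k x"
proof -
  have ldens: "(\<lambda>_. c) \<in> omega_xi lower_density k x \<longleftrightarrow> (\<forall>\<^sub>F j in sequentially. alt j \<or> b j = c)" if "c < 2" for c
    using that by (auto simp: omega_lower_density dest: fun_cong)
  have sub: "omega_xi lower_density k x \<subseteq> {\<lambda>_. 0, \<lambda>_. 1}"
    by (auto simp: omega_lower_density less_2_cases_iff)
  have ne: "(\<lambda>_. 0) \<noteq> (\<lambda>_. 1 :: nat)" by (auto dest: fun_cong)
  have A: "omega_xi lower_density k x = {\<lambda>_. 0, \<lambda>_. 1}" if "i \<in> {1, 2}"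
  proof -
    have "\<forall>\<^sub>F j in sequentially. alt j \<or> b j = c" for c
      using alternating[OF that] by (rule eventually_mono) simp
    then show ?thesis using sub ldens[of 0] ldens[of 1] by auto
  qed
  have C: "omega_xi lower_density k x = {}" if "i \<in> {3, 5}"
    using sub ldens[of 0] ldens[of 1] steady[OF that, of 0] steady[OF that, of 1]
    by (auto simp: frequently_def)
  have M: "omega_xi lower_density k x = {\<lambda>_. 0}" if "i \<in> {4, 6}"
    using sub ldens[of 0] ldens[of 1] mixed(1)[OF that] mixed(2)[OF that]
    by (auto simp: frequently_def)
  have Bu: "omega_xi upper_banach k x = {\<lambda>_. 0, \<lambda>_. 1}" if "i \<in> {1, 3, 4}"
    using omega_upper_banach_1 omega_upper_density that assms(1) by auto
  have Bu': "{\<lambda>_. 0, \<lambda>_. 1} \<subset> omega_xi upper_banach k x" if "i \<in> {2, 5, 6}"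
    using omega_upper_banach_2 omega_upper_density that assms(1) by auto
  note * = omega_upper_banach_omega_shift
  show ?thesis
    unfolding case_prime_def Let_def omega_lower_banach omega_upper_density
  proof (intro conjI impI)
    show "{} \<subset> omega_xi lower_density k x" if "i = 1" using A that by auto
  qed (use A C M Bu Bu' * ne in \<open>simp_all add: psubset_insert_iff\<close>)
qed

end

section \<open>A criterion for DC1 pairs\<close>

subsection \<open>Pairs of points\<close>

text \<open>At \<open>p (Suc j)\<close> the last main part outweighs everything before it, so the
  frequency of closeness is near 0 or near 1 there.\<close>

lemma DC1_pairI:
  assumes differ: "\<exists>\<^sub>F j in sequentially. \<forall>n. 2 * p j + j \<le> n \<longrightarrow> n < p (Suc j) \<longrightarrow> x n \<noteq> y n"
    and agree: "\<exists>\<^sub>F j in sequentially. \<forall>n. 2 * p j + j \<le> n \<longrightarrow> n < p (Suc j) \<longrightarrow> x n = y n"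
  shows "DC1_pair x y"
proof -
  define I where "I t n = {i. i < n \<and> sdist ((shift ^^ i) x) ((shift ^^ i) y) < t}" for t n
  have Phi: "Phi x y n t = card (I t n) / n" for n t by (simp add: Phi_def I_def)
  \<comment> \<open>The scale 1/2 works because distance below 1/2 forces equal first
    symbols.\<close>
  have "liminf (\<lambda>n. ereal (Phi x y n (1/2))) \<le> ereal e" if "e > 0" for e
  proof (rule Liminf_le_if_frequently, rule frequently_p)
    obtain J where J: "real 3 \<le> e * Suc J" using ex_zone_fine[OF \<open>e > 0\<close>] by blast
    show "\<exists>\<^sub>F j in sequentially. ereal (Phi x y (p (Suc j)) (1/2)) \<le> ereal e"
      using differ
    proof (rule frequently_rev_mp, intro eventually_mono[OF eventually_ge_at_top[of J]] impI)
      fix j assume j: "J \<le> j" "\<forall>n. 2 * p j + j \<le> n \<longrightarrow> n < p (Suc j) \<longrightarrow> x n \<noteq> y n"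
      have "I (1/2) (p (Suc j)) \<subseteq> {0..<2 * p j + j}"
      proof
        fix n assume n: "n \<in> I (1/2) (p (Suc j))"
        then have "(shift ^^ n) x 0 = (shift ^^ n) y 0"
          by (intro sdist_less_imp_eq[of _ _ 1]) (auto simp: I_def)
        then show "n \<in> {0..<2 * p j + j}"
          using j(2) n by (cases "2 * p j + j \<le> n") (auto simp: I_def shift_funpow)
      qed
      from card_mono[OF _ this] have "card (I (1/2) (p (Suc j))) \<le> 2 * p j + j" by simp
      also have "\<dots> \<le> 3 * p j" using p_ge[of j] by simp
      finally have "Suc J * card (I (1/2) (p (Suc j))) \<le> Suc J * (3 * p j)" by (rule mult_le_mono2)
      also have "\<dots> \<le> 3 * p (Suc j)" using j(1) by (simp add: p_Suc mult_le_mono1 del: mult_Suc)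
      finally have "card (I (1/2) (p (Suc j))) \<le> e * real (p (Suc j))"
        by (rule ratio_le_if_zone[OF _ J])
      then show "ereal (Phi x y (p (Suc j)) (1/2)) \<le> ereal e"
        unfolding Phi using \<open>e > 0\<close> by (intro ereal_ratio_le) auto
    qed
  qed
  then have "\<not> liminf (\<lambda>n. ereal (Phi x y n (1/2))) > 0" by (rule ereal_not_pos_if_le)
  moreover have "0 \<le> liminf (\<lambda>n. ereal (Phi x y n (1/2)))"
    by (rule Liminf_bounded) (simp add: Phi)
  ultimately have low: "liminf (\<lambda>n. ereal (Phi x y n (1/2))) = 0" by simp
  have "limsup (\<lambda>n. ereal (Phi x y n t)) = 1" if "t > 0" for t
  proof (rule antisym)
    have "card (I t n) \<le> n" for n
      using card_mono[of "{..<n}" "I t n"] by (auto simp: I_def)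
    then have "ereal (Phi x y n t) \<le> ereal 1" for n
      unfolding Phi by (intro ereal_ratio_le) auto
    then show "limsup (\<lambda>n. ereal (Phi x y n t)) \<le> 1"
      by (intro Limsup_bounded always_eventually allI) (simp add: one_ereal_def)
  next
    obtain m where m: "1 / 2 ^ m < t" using ex_half_power_less \<open>t > 0\<close> by blast
    have "ereal (1 - e) \<le> limsup (\<lambda>n. ereal (Phi x y n t))" if "e > 0" for e
    proof (rule le_Limsup_if_frequently, rule frequently_p)
      obtain J where J: "real 4 \<le> e * Suc J" using ex_zone_fine[OF \<open>e > 0\<close>] by blast
      show "\<exists>\<^sub>F j in sequentially. ereal (1 - e) \<le> ereal (Phi x y (p (Suc j)) t)"
        using agree
      proof (rule frequently_rev_mp, intro eventually_mono[OF eventually_ge_at_top[of "max J m"]] impI)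
        fix j assume j: "max J m \<le> j" "\<forall>n. 2 * p j + j \<le> n \<longrightarrow> n < p (Suc j) \<longrightarrow> x n = y n"
        \<comment> \<open>The last \<open>m\<close> positions are dropped so that \<open>m\<close>
          further symbols agree; with \<open>m \<le> j\<close> the total loss is at most
          \<open>4 * p j\<close>.\<close>
        have "{2 * p j + j..<p (Suc j) - m} \<subseteq> I t (p (Suc j))"
        proof
          fix n assume n: "n \<in> {2 * p j + j..<p (Suc j) - m}"
          have "sdist ((shift ^^ n) x) ((shift ^^ n) y) \<le> 1 / 2 ^ m"
            using n j(2) by (intro sdist_le_if_eq) (auto simp: shift_funpow)
          then show "n \<in> I t (p (Suc j))" using m n by (auto simp: I_def)
        qed
        moreover have "finite (I t (p (Suc j)))" by (simp add: I_def)
        ultimately have "card {2 * p j + j..<p (Suc j) - m} \<le> card (I t (p (Suc j)))" by (rule card_mono[rotated])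
        then have "p (Suc j) \<le> card (I t (p (Suc j))) + m + (2 * p j + j)" by simp
        then have le: "p (Suc j) \<le> card (I t (p (Suc j))) + 4 * p j" using j(1) p_ge[of j] by simp
        have "Suc J * (4 * p j) \<le> 4 * p (Suc j)" using j(1) by (simp add: p_Suc mult_le_mono1 del: mult_Suc)
        then have "real (4 * p j) \<le> e * real (p (Suc j))" by (rule ratio_le_if_zone[OF _ J])
        then have "(1 - e) * real (p (Suc j)) \<le> card (I t (p (Suc j)))"
          using le by (simp add: algebra_simps)
        then show "ereal (1 - e) \<le> ereal (Phi x y (p (Suc j)) t)"
          unfolding Phi using p_ge[of "Suc j"] by (intro ereal_ratio_ge) auto
      qed
    qed
    then have "ereal 1 \<le> limsup (\<lambda>n. ereal (Phi x y n t)) + ereal e" if "e > 0" for e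
      using that by (cases "limsup (\<lambda>n. ereal (Phi x y n t))") (fastforce simp: algebra_simps)+
    then show "1 \<le> limsup (\<lambda>n. ereal (Phi x y n t))"
      using ereal_le_epsilon2[of "ereal 1"] by (simp add: one_ereal_def)
  qed
  then show ?thesis using low unfolding DC1_pair_def by (intro conjI exI[of _ "1/2"]) auto
qed

end

section \<open>Existence of zoned points\<close>

section \<open>The construction\<close>

primrec zone_start :: "nat \<Rightarrow> nat \<Rightarrow> nat" where
  "zone_start N 0 = N"
| "zone_start N (Suc j) = (j + 10) * zone_start N j"

text \<open>Stage \<open>j\<close> is final only below \<open>zone_start N j\<close>; its values
  beyond are provisional and overwritten. Recursion on stages makes copying from earlier positions
  primitive recursive.\<close>

primrec approx :: "(nat \<Rightarrow> nat) \<Rightarrow> nat \<Rightarrow> nat \<Rightarrow> (nat \<Rightarrow> bool) \<Rightarrow> (nat \<Rightarrow> nat) \<Rightarrow> nat \<Rightarrow> nat \<Rightarrow> nat" where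
  "approx u N P alt b 0 = u"
| "approx u N P alt b (Suc j) = (\<lambda>n.
     if n < zone_start N j then approx u N P alt b j n
     else if n < 2 * zone_start N j then approx u N P alt b j (n - zone_start N j)
     else if n < 2 * zone_start N j + j then n mod P
     else if alt j then (b j + n div Suc j) mod 2 else b j)"

text \<open>Stage \<open>n\<close> is already final at position \<open>n\<close>, because
  \<open>n < zone_start N n\<close> for \<open>N \<ge> 1\<close>.\<close>

definition zone_point :: "(nat \<Rightarrow> nat) \<Rightarrow> nat \<Rightarrow> nat \<Rightarrow> (nat \<Rightarrow> bool) \<Rightarrow> (nat \<Rightarrow> nat) \<Rightarrow> nat \<Rightarrow> nat" where
  "zone_point u N P alt b n = approx u N P alt b n n"

lemma zone_start_bounds:
  assumes "N \<ge> 1"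
  shows "j + 1 \<le> zone_start N j" "i \<le> j \<Longrightarrow> zone_start N i \<le> zone_start N j"
  by (rule zone_bounds[of "zone_start N"]; use assms in simp)+

lemma approx_stable:
  assumes "N \<ge> 1" "n < zone_start N j"
  shows "approx u N P alt b (j + d) n = approx u N P alt b j n"
proof (induction d)
  case (Suc d)
  then show ?case using assms zone_start_bounds(2)[OF assms(1), of j "j + d"] by auto
qed simp

lemma zone_point_eq:
  assumes "N \<ge> 1" "n < zone_start N j"
  shows "zone_point u N P alt b n = approx u N P alt b j n"
proof -
  have "n < zone_start N n" using zone_start_bounds(1)[OF assms(1), of n] by simp
  then show ?thesis
    using approx_stable[OF assms(1), of n n u P alt b "j - n"] approx_stable[OF assms, of u P alt b "n - j"]
    by (cases "n \<le> j") (auto simp: zone_point_def)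
qed

lemma zone_point_prefix: "N \<ge> 1 \<Longrightarrow> n < N \<Longrightarrow> zone_point u N P alt b n = u n"
  by (subst zone_point_eq[of _ _ 0]) auto

lemma zoned_zone_point:
  assumes "N \<ge> 1" "P = 1 \<or> P = 2" "\<And>j. b j < 2"
  shows "zoned (zone_point u N P alt b) (zone_start N) b alt P"
proof
  fix j n
  let ?p = "zone_start N" and ?x = "zone_point u N P alt b"
  have step: "?x n = approx u N P alt b (Suc j) n" if "n < ?p (Suc j)"
    using zone_point_eq[OF assms(1) that] .
  have "?p (Suc j) = 10 * ?p j + j * ?p j" by (simp add: algebra_simps)
  then have small: "2 * ?p j + j \<le> ?p (Suc j)" using zone_start_bounds(1)[OF assms(1), of j] by linarith
  show "?x n = ?x (n - ?p j)" if "?p j \<le> n" "n < 2 * ?p j"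
    using that small step zone_point_eq[OF assms(1), of "n - ?p j" j] by simp
  show "?x n = n mod P" if "2 * ?p j \<le> n" "n < 2 * ?p j + j"
    using that small step by simp
  show "?x n = (if alt j then (b j + n div Suc j) mod 2 else b j)" if "2 * ?p j + j \<le> n" "n < ?p (Suc j)"
    using that step by simp
qed (use assms in auto)

lemma zone_point_Sigma:
  assumes "u \<in> Sigma k" "k \<ge> 2" "P = 1 \<or> P = 2" "\<And>j. b j < 2"
  shows "zone_point u N P alt b \<in> Sigma k"
proof -
  have le: "(m::nat) < k" if "m < 2" for m using assms(2) that by simp
  have "approx u N P alt b j n < k" for j n
  proof (induction j arbitrary: n)
    case 0
    then show ?case using assms(1) by (simp add: Sigma_def)
  next
    case (Suc j)
    have "n mod P < 2" using assms(3) by auto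
    then show ?case using Suc le assms(4)[of j] by auto
  qed
  then show ?thesis by (simp add: Sigma_def zone_point_def)
qed

section \<open>Parameters for the six cases and the scrambled family\<close>

text \<open>Zones congruent to 2 modulo 3 carry the parameter, each entry infinitely often; in the other
  zones all points of the family agree.\<close>

definition ctrl :: "(nat \<Rightarrow> bool) \<Rightarrow> nat \<Rightarrow> nat" where
  "ctrl \<alpha> j = (if j mod 3 = 0 then 0 else if j mod 3 = 1 then 1
     else of_bool (\<alpha> (fst (prod_decode (j div 3)))))"

text \<open>In cases 4 and 6 the zones divisible by 3 are constantly 0 and all others alternate, so
  0 stays in the lower density limit set while 1 drops out. In cases 3 and 5 constant zones of both
  symbols recur.\<close>

definition alternates :: "nat \<Rightarrow> nat \<Rightarrow> bool" where
  "alternates i j \<longleftrightarrow> i \<in> {1, 2} \<or> i \<in> {4, 6} \<and> j mod 3 \<noteq> 0"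

definition filler_period :: "nat \<Rightarrow> nat" where
  "filler_period i = (if i \<in> {1, 3, 4} then 1 else 2)"

definition case_point :: "nat \<Rightarrow> (nat \<Rightarrow> nat) \<Rightarrow> nat \<Rightarrow> (nat \<Rightarrow> bool) \<Rightarrow> nat \<Rightarrow> nat" where
  "case_point i u N \<alpha> = zone_point u N (filler_period i) (alternates i) (ctrl \<alpha>)"

lemma ctrl_less: "ctrl \<alpha> j < 2"
  by (simp add: ctrl_def)

lemma zoned_case_point:
  assumes "N \<ge> 1"
  shows "zoned (case_point i u N \<alpha>) (zone_start N) (ctrl \<alpha>) (alternates i) (filler_period i)"
  unfolding case_point_def using assms by (intro zoned_zone_point ctrl_less) (auto simp: filler_period_def)

lemma frequently_mod_3:
  assumes "r < (3::nat)" "\<And>j. j mod 3 = r \<Longrightarrow> Q j"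
  shows "\<exists>\<^sub>F j in sequentially. Q j"
  unfolding frequently_sequentially
proof
  fix n
  have "(3 * n + r) mod 3 = r" using assms(1) by simp
  then show "\<exists>j\<ge>n. Q j" using assms(2) by (intro exI[of _ "3 * n + r"]) auto
qed

lemma case_point_props:
  assumes "N \<ge> 1" "u \<in> Sigma k" "k \<ge> 2" "i \<in> {1..6}"
  shows "case_point i u N \<alpha> \<in> {x \<in> Rec k - BR k. case_prime i k x}"
proof -
  interpret zoned "case_point i u N \<alpha>" "zone_start N" "ctrl \<alpha>" "alternates i" "filler_period i"
    by (rule zoned_case_point[OF assms(1)])
  have Sig: "case_point i u N \<alpha> \<in> Sigma k"
    unfolding case_point_def using assms by (intro zone_point_Sigma ctrl_less) (auto simp: filler_period_def)
  have both: "\<exists>\<^sub>F j in sequentially. alternates i j \<or> ctrl \<alpha> j = c" if "c < 2" for c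
    using that by (intro frequently_mod_3[of c]) (auto simp: ctrl_def less_2_cases_iff)
  have "case_prime i k (case_point i u N \<alpha>)"
  proof (rule case_prime_if[OF Sig assms(3) both])
    show "filler_period i = (if i \<in> {1, 3, 4} then 1 else 2)" by (rule filler_period_def)
    show "\<forall>\<^sub>F j in sequentially. alternates i j" if "i \<in> {1, 2}"
      using that by (simp add: alternates_def)
    show "\<exists>\<^sub>F j in sequentially. \<not> alternates i j \<and> ctrl \<alpha> j \<noteq> c" if "i \<in> {3, 5}" "c < 2" for c
      using that by (intro frequently_mod_3[of "1 - c"]) (auto simp: alternates_def ctrl_def less_2_cases_iff)
    show "\<forall>\<^sub>F j in sequentially. alternates i j \<or> ctrl \<alpha> j = 0" if "i \<in> {4, 6}"
      using that by (intro always_eventually) (auto simp: alternates_def ctrl_def)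
    show "\<exists>\<^sub>F j in sequentially. \<not> alternates i j \<and> ctrl \<alpha> j \<noteq> 1" if "i \<in> {4, 6}"
      using that by (intro frequently_mod_3[of 0]) (auto simp: alternates_def ctrl_def)
  qed
  then show ?thesis using x_in_Rec_not_BR[OF Sig assms(3) both] by blast
qed

lemma case_point_DC1:
  assumes "N \<ge> 1" "i \<in> {1..6}" "\<alpha> \<noteq> \<beta>"
  shows "DC1_pair (case_point i u N \<alpha>) (case_point i u N \<beta>)"
proof -
  interpret a: zoned "case_point i u N \<alpha>" "zone_start N" "ctrl \<alpha>" "alternates i" "filler_period i"
    by (rule zoned_case_point[OF assms(1)])
  interpret b: zoned "case_point i u N \<beta>" "zone_start N" "ctrl \<beta>" "alternates i" "filler_period i"
    by (rule zoned_case_point[OF assms(1)])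
  obtain l where l: "\<alpha> l \<noteq> \<beta> l" using assms(3) by (auto simp: fun_eq_iff)
  show ?thesis
  proof (rule a.DC1_pairI)
    show "\<exists>\<^sub>F j in sequentially. \<forall>n. 2 * zone_start N j + j \<le> n \<longrightarrow> n < zone_start N (Suc j) \<longrightarrow>
        case_point i u N \<alpha> n \<noteq> case_point i u N \<beta> n"
      unfolding frequently_sequentially
    proof
      fix m
      \<comment> \<open>A zone governed by entry \<open>l\<close> of the parameter; the second
        component \<open>m\<close> pushes it beyond any bound.\<close>
      define j where "j = 3 * prod_encode (l, m) + 2"
      have j: "j mod 3 = 2" "j div 3 = prod_encode (l, m)" unfolding j_def by (simp_all del: add_2_eq_Suc')
      then have "{ctrl \<alpha> j, ctrl \<beta> j} = {0, 1}" using l by (auto simp: ctrl_def)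
      then have "ctrl \<alpha> j = 0 \<and> ctrl \<beta> j = 1 \<or> ctrl \<alpha> j = 1 \<and> ctrl \<beta> j = 0" by (auto simp: doubleton_eq_iff)
      \<comment> \<open>With a common alternation pattern, opposite \<open>ctrl\<close> values give
        complementary main parts, as opposite constants or opposite phases.\<close>
      then have "\<forall>n. 2 * zone_start N j + j \<le> n \<longrightarrow> n < zone_start N (Suc j) \<longrightarrow>
          case_point i u N \<alpha> n \<noteq> case_point i u N \<beta> n"
        using a.main[of j] b.main[of j] by (auto simp: mod2_eq_if)
      moreover have "m \<le> j" using le_prod_encode_2[of m l] by (simp add: j_def)
      ultimately show "\<exists>j\<ge>m. \<forall>n. 2 * zone_start N j + j \<le> n \<longrightarrow> n < zone_start N (Suc j) \<longrightarrow>
          case_point i u N \<alpha> n \<noteq> case_point i u N \<beta> n" by blast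
    qed
    show "\<exists>\<^sub>F j in sequentially. \<forall>n. 2 * zone_start N j + j \<le> n \<longrightarrow> n < zone_start N (Suc j) \<longrightarrow>
        case_point i u N \<alpha> n = case_point i u N \<beta> n"
    proof (rule frequently_mod_3[of 0], simp, intro allI impI)
      fix j n assume "j mod 3 = 0" "2 * zone_start N j + j \<le> n" "n < zone_start N (Suc j)"
      then show "case_point i u N \<alpha> n = case_point i u N \<beta> n"
        using a.main[of j n] b.main[of j n] by (simp add: ctrl_def)
    qed
  qed
qed

section \<open>Uncountability of the family and final assembly\<close>

text \<open>Yields injectivity of the family: equal points for different parameters would form a DC1
  pair.\<close>

lemma not_DC1_pair_refl: "\<not> DC1_pair x x"
proof
  assume "DC1_pair x x"
  then obtain s where s: "s > 0" "liminf (\<lambda>n. ereal (Phi x x n s)) = 0" by (auto simp: DC1_pair_def)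
  have "Phi x x n s = n / n" for n using s(1) by (simp add: Phi_def sdist_def)
  then have "\<forall>\<^sub>F n in sequentially. ereal 1 \<le> ereal (Phi x x n s)"
    by (intro eventually_mono[OF eventually_gt_at_top[of 0]]) auto
  then have "ereal 1 \<le> liminf (\<lambda>n. ereal (Phi x x n s))" by (rule Liminf_bounded)
  then show False using s(2) by simp
qed

lemma uncountable_UNIV_nat_bool: "uncountable (UNIV :: (nat \<Rightarrow> bool) set)"
proof
  assume "countable (UNIV :: (nat \<Rightarrow> bool) set)"
  then obtain f :: "nat \<Rightarrow> nat \<Rightarrow> bool" where "surj f" using uncountable_def by blast
  then obtain n where "f n = (\<lambda>m. \<not> f m m)" by (metis surjD)
  then have "f n n = (\<not> f n n)" by (rule fun_cong)
  then show False by simp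
qed

theorem theoremB:
  fixes k i :: nat
  assumes "k \<ge> 2" and "i \<in> {1..6}"
  shows "dense_in_Sigma k {x \<in> Rec k - BR k. case_prime i k x} \<and>
         (\<exists>D \<subseteq> {x \<in> Rec k - BR k. case_prime i k x}. uncountable D \<and> DC1_scrambled D)"
proof
  let ?S = "{x \<in> Rec k - BR k. case_prime i k x}"
  show "dense_in_Sigma k ?S"
    unfolding dense_in_Sigma_def
  proof (intro conjI ballI allI impI)
    fix v and e :: real assume v: "v \<in> Sigma k" and "e > 0"
    then obtain m where m: "1 / 2 ^ m < e" using ex_half_power_less by blast
    \<comment> \<open>The word kept from \<open>v\<close> has length \<open>Suc m\<close>, which
      covers \<open>m\<close> symbols and is positive even for \<open>m = 0\<close>.\<close>
    let ?y = "case_point i v (Suc m) (\<lambda>_. False)"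
    have "sdist v ?y \<le> 1 / 2 ^ m"
      by (intro sdist_le_if_eq) (simp add: case_point_def zone_point_prefix)
    moreover have "?y \<in> ?S" using assms v by (intro case_point_props) auto
    ultimately show "\<exists>y\<in>?S. sdist v y < e" using m by (intro bexI[of _ ?y]) auto
  qed (auto simp: Rec_def)
  let ?f = "case_point i (\<lambda>_. 0) 1"
  have DC1: "DC1_pair (?f \<alpha>) (?f \<beta>)" if "\<alpha> \<noteq> \<beta>" for \<alpha> \<beta>
    using assms(2) that by (intro case_point_DC1) auto
  then have "inj ?f" by (metis injI not_DC1_pair_refl)
  then have "uncountable (range ?f)" using uncountable_UNIV_nat_bool by (simp add: countable_image_inj_eq)
  moreover have "DC1_scrambled (range ?f)"
    unfolding DC1_scrambled_def
  proof (intro conjI ballI impI)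
    have "?f (\<lambda>_. True) \<noteq> ?f (\<lambda>_. False)" using \<open>inj ?f\<close> by (metis injD)
    then show "\<exists>x\<in>range ?f. \<exists>y\<in>range ?f. x \<noteq> y" by blast
    fix x y assume "x \<in> range ?f" "y \<in> range ?f" "x \<noteq> y"
    then obtain \<alpha> \<beta> where "x = ?f \<alpha>" "y = ?f \<beta>" "\<alpha> \<noteq> \<beta>" by auto
    then show "DC1_pair x y" using DC1 by simp
  qed
  moreover have "?f \<alpha> \<in> ?S" for \<alpha>
    using assms by (intro case_point_props) (auto simp: Sigma_def)
  then have "range ?f \<subseteq> ?S" by blast
  ultimately show "\<exists>D \<subseteq> ?S. uncountable D \<and> DC1_scrambled D" by (intro exI[of _ "range ?f"] conjI)
qed

end
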